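(* Consider the constrained convex program and its standing assumptions (i)–(iv) described in the context, and assume further that: (a) $h=\mathrm{Ind}_{\mathcal{C}}$ where $\mathcal{C}$ is compact and $(\nu,q)$-uniformly convex for some $q\ge 2$ and $\nu>0$; (b) for some $\epsilon>0$, $\inf\{\|\nabla f(x)+\sum_{i=1}^m z_i\nabla g_i(x)\| : (x,z)\in\mathcal{A}_\epsilon,\ x\in\mathcal{C}\}>0$, with $\mathcal{A}_\epsilon$ as defined in the context. Let $\{(x^k,z^k)\}$ be generated by the algorithm described in the context with parameters satisfying: $\{\lambda_k\}$ positive and increasing, $\lambda_k=\Theta(k^{\tau})$ and $\lambda_{k+1}-\lambda_k=\mathcal{O}(k^{-(1-\tau)})$ for some $\tau\in(0,1)$; $\{\alpha_k\}\subset(0,1]$ nonincreasing with $\alpha_k=\Theta(k^{-p})$, $p\in(\tau,1)$; $\{\sigma_k\}$ positive with $\sigma_k\le\lambda_k$ and $\sigma_k=\Theta(k^{-(1+\gamma)})$ for some $\gamma>0$. Let $L^*$ be the optimal value of the program, $\mu:=1-2/q$ and $\omega:=\min\{p-\tau,1-p+\tau\}$. Then $$\max\{|f(x^k)+h(x^k)-L^*|,\ \|[g(x^k)]_+\|\}=\begin{cases}\mathcal{O}(k^{-\tau}) & \text{if }\mu=0,\\ \mathcal{O}\big(\max\big\{\frac{1}{k^{(1-\mu)\omega+(p-\tau)}},\frac{1}{k^{\tau}}\big\}\big) & \text{if }\mu\in(0,1).\end{cases}$$ (In particular, when $\mathcal{C}$ is strongly convex, i.e. $q=2$, $\mu=0$,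 the rate can be made arbitrarily close to $\mathcal{O}(1/k)$ by choosing $\tau\in(0,1)$ arbitrarily close to $1$ and $p\in(\tau,1)$.)
   Context: Conventions: $\|\cdot\|$ is the Euclidean norm, vector inequalities and maxima are componentwise, $[a]_+=\max\{a,0\}$ (componentwise for vectors), $\mathrm{dom}\,h=\{x:h(x)<\infty\}$, $\mathrm{Ind}_{\mathcal{C}}$ is the indicator function ($0$ on $\mathcal{C}$, $+\infty$ elsewhere). Asymptotic notation is as $k\to\infty$. Problem: $\min_{x\in\mathbb{R}^n} f(x)+h(x)$ subject to $g(x):=(g_1(x),\dots,g_m(x))^T\le 0$. Standing assumptions: (i) $f:\mathbb{R}^n\to\mathbb{R}$ is convex and differentiable with $L_f$-Lipschitz gradient, $L_f>0$. (ii) $h:\mathbb{R}^n\to(-\infty,+\infty]$ is proper, closed, convex, $\sup_{x,x'\in\mathrm{dom}\,h}\|x-x'\|\le D$ for some finite $D>0$, and for every $u\in\mathbb{R}^n$ the problem $\min_v\langle v,u\rangle+h(v)$ has a minimizer. (iii) Each $g_i:\mathbb{R}^n\to\mathbb{R}$ is convex and differentiable, and there is $L_{g_i}>0$ with $\|\nabla g_i(x)-\nabla g_i(x')\|\le L_{g_i}\|x-x'\|$ for all $x,x'\in\mathrm{dom}\,h$. (iv) There is a KKT point $(x^*,z^* )$: $0\in\nabla f(x^* )+\partial h(x^* )+\sum_{i=1}^m z_i^*\nabla g_i(x^* )$, $g(x^* )\le 0$, $z^*\ge 0$, $\langle z^*,g(x^* )\rangle=0$. Uniform convexity: a convex set $\mathcal{D}\subseteq\mathbb{R}^n$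 is $(\nu,q)$-uniformly convex ($q\ge2$, $\nu>0$) if for all $x,y\in\mathcal{D}$, $t\in[0,1]$ and $w\in\mathbb{R}^n$ with $\|w\|=1$, one has $tx+(1-t)y+t(1-t)\nu\|x-y\|^q w\in\mathcal{D}$; it is called strongly convex when $q=2$. For $\epsilon>0$: $\mathcal{A}_\epsilon=\{(x,z)\in\mathbb{R}^n\times\mathbb{R}^m_+ : g_i(x)\le\epsilon\ \forall i,\text{ and for every } i,\ g_i(x)<-\epsilon\text{ implies } z_i=0\}$. For $\lambda>0$, let $\Psi_\lambda(x,z)=\frac{\lambda}{2}\sum_{i=1}^m\big([g_i(x)+z_i/\lambda]_+^2-(z_i/\lambda)^2\big)$ and $F_\lambda(x,z)=f(x)+\Psi_\lambda(x,z)$. Algorithm: choose $(x^0,z^0)\in\mathrm{dom}\,h\times\mathbb{R}^m_+$, a positive increasing sequence $\{\lambda_k\}$ ($\lambda_{k+1}>\lambda_k>0$) with $\lambda_k\to\infty$, a positive summable sequence $\{\sigma_k\}$ with $\sigma_k\le\lambda_k$, and stepsizes $\alpha_k\in[0,1]$. For $k=0,1,2,\dots$: $v^k\in\mathrm{Argmin}_{v}\ \langle\nabla_xF_{\lambda_k}(x^k,z^k),v\rangle+h(v)$ (any minimizer); $x^{k+1}=x^k+\alpha_k(v^k-x^k)$; $z^{k+1}=z^k+\sigma_k\max\{-z^k/\lambda_k,\ g(x^{k+1})\}$. *)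

theory Defs
  imports "HOL-Analysis.Analysis" "HOL-Library.Landau_Symbols"
begin

definition grad :: "('a::real_inner \<Rightarrow> real) \<Rightarrow> 'a \<Rightarrow> 'a" where
  "grad f x = (THE D. GDERIV f x :> D)"

definition pos_part :: "real ^ 'm \<Rightarrow> real ^ 'm" where
  "pos_part a = (\<chi> i. max (a $ i) 0)"

definition eff_dom :: "('a \<Rightarrow> ereal) \<Rightarrow> 'a set" where
  "eff_dom h = {x. h x < \<infinity>}"

definition epi :: "('a \<Rightarrow> ereal) \<Rightarrow> ('a \<times> real) set" where
  "epi h = {(x, r). h x \<le> ereal r}"

definition proper_closed_convex :: "('a::euclidean_space \<Rightarrow> ereal) \<Rightarrow> bool" where
  "proper_closed_convex h \<longleftrightarrow>
     (\<forall>x. h x \<noteq> -\<infinity>) \<and> eff_dom h \<noteq> {} \<and> closed (epi h) \<and> convex (epi h)"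

(* For proper h this is empty outside eff_dom h, because h x + ereal r = \<infinity> there. *)
definition subdifferential :: "('a::real_inner \<Rightarrow> ereal) \<Rightarrow> 'a \<Rightarrow> 'a set" where
  "subdifferential h x = {s. \<forall>y. h x + ereal (inner s (y - x)) \<le> h y}"

definition Ind :: "'a set \<Rightarrow> 'a \<Rightarrow> ereal" where
  "Ind C x = (if x \<in> C then 0 else \<infinity>)"

definition is_minimizer :: "('a \<Rightarrow> ereal) \<Rightarrow> 'a \<Rightarrow> bool" where
  "is_minimizer \<phi> v \<longleftrightarrow> is_arg_min \<phi> (\<lambda>_. True) v"

definition linear_oracle_obj :: "('a::real_inner \<Rightarrow> ereal) \<Rightarrow> 'a \<Rightarrow> 'a \<Rightarrow> ereal" where
  "linear_oracle_obj h u v = ereal (inner u v) + h v"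

(* The order on real ^ 'm is componentwise. *)
definition optimal_value ::
  "(real ^ 'n \<Rightarrow> real) \<Rightarrow> (real ^ 'n \<Rightarrow> ereal) \<Rightarrow> (real ^ 'n \<Rightarrow> real ^ 'm) \<Rightarrow> ereal" where
  "optimal_value f h g = (INF x\<in>{x. g x \<le> 0}. ereal (f x) + h x)"

definition is_KKT_point ::
  "(real ^ 'n \<Rightarrow> real) \<Rightarrow> (real ^ 'n \<Rightarrow> ereal) \<Rightarrow> (real ^ 'n \<Rightarrow> real ^ 'm) \<Rightarrow>
   real ^ 'n \<Rightarrow> real ^ 'm \<Rightarrow> bool" where
  "is_KKT_point f h g x z \<longleftrightarrow>
     (\<exists>s\<in>subdifferential h x.
        0 = grad f x + s + (\<Sum>i\<in>UNIV. (z $ i) *\<^sub>R grad (\<lambda>y. g y $ i) x)) \<and>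
     g x \<le> 0 \<and> 0 \<le> z \<and> inner z (g x) = 0"

definition uniformly_convex_set :: "'a::real_normed_vector set \<Rightarrow> real \<Rightarrow> real \<Rightarrow> bool" where
  "uniformly_convex_set C \<nu> q \<longleftrightarrow>
     convex C \<and>
     (\<forall>x\<in>C. \<forall>y\<in>C. \<forall>t\<in>{0..1}. \<forall>w. norm w = 1 \<longrightarrow>
        t *\<^sub>R x + (1 - t) *\<^sub>R y + (t * (1 - t) * \<nu> * norm (x - y) powr q) *\<^sub>R w \<in> C)"

definition A_set :: "(real ^ 'n \<Rightarrow> real ^ 'm) \<Rightarrow> real \<Rightarrow> ((real ^ 'n) \<times> (real ^ 'm)) set" where
  "A_set g \<epsilon> = {(x, z). 0 \<le> z \<and> (\<forall>i. g x $ i \<le> \<epsilon>) \<and> (\<forall>i. g x $ i < -\<epsilon> \<longrightarrow> z $ i = 0)}"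

definition Psi ::
  "(real ^ 'n \<Rightarrow> real ^ 'm) \<Rightarrow> real \<Rightarrow> real ^ 'n \<Rightarrow> real ^ 'm \<Rightarrow> real" where
  "Psi g l x z = l / 2 * (\<Sum>i\<in>UNIV. (max (g x $ i + z $ i / l) 0)\<^sup>2 - (z $ i / l)\<^sup>2)"

definition F_aug ::
  "(real ^ 'n \<Rightarrow> real) \<Rightarrow> (real ^ 'n \<Rightarrow> real ^ 'm) \<Rightarrow> real \<Rightarrow> real ^ 'n \<Rightarrow> real ^ 'm \<Rightarrow> real" where
  "F_aug f g l x z = f x + Psi g l x z"

definition algorithm_run ::
  "(real ^ 'n \<Rightarrow> real) \<Rightarrow> (real ^ 'n \<Rightarrow> ereal) \<Rightarrow> (real ^ 'n \<Rightarrow> real ^ 'm) \<Rightarrow>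
   (nat \<Rightarrow> real) \<Rightarrow> (nat \<Rightarrow> real) \<Rightarrow> (nat \<Rightarrow> real) \<Rightarrow>
   (nat \<Rightarrow> real ^ 'n) \<Rightarrow> (nat \<Rightarrow> real ^ 'n) \<Rightarrow> (nat \<Rightarrow> real ^ 'm) \<Rightarrow> bool" where
  "algorithm_run f h g lam sig alp v x z \<longleftrightarrow>
     x 0 \<in> eff_dom h \<and> 0 \<le> z 0 \<and>
     (\<forall>k. 0 < lam k) \<and> strict_mono lam \<and> filterlim lam at_top sequentially \<and>
     (\<forall>k. 0 < sig k \<and> sig k \<le> lam k) \<and> summable sig \<and>
     (\<forall>k. alp k \<in> {0..1}) \<and>
     (\<forall>k. is_minimizer (linear_oracle_obj h (grad (\<lambda>y. F_aug f g (lam k) y (z k)) (x k))) (v k) \<and>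
          x (Suc k) = x k + alp k *\<^sub>R (v k - x k) \<and>
          z (Suc k) = z k + sig k *\<^sub>R (\<chi> i. max (- (z k $ i / lam k)) (g (x (Suc k)) $ i)))"

end

theory Submission
  imports Defs
begin

text \<open>
  Put \<open>E k = F\<^sub>k (x k) - f x\<^sup>* + c / lam k\<close>, where \<open>F\<^sub>k\<close> is the augmented Lagrangian of step \<open>k\<close>
  and the last term makes the KKT saddle inequality yield
  \<open>E k \<ge> (lam k / 4) * (norm [g (x k)]\<^sub>+)\<^sup>2 \<ge> 0\<close>. A conditional gradient step changes \<open>F\<^sub>k\<close> by at
  most \<open>- alp * G + K * lam * alp\<^sup>2 * (norm (x - v))\<^sup>2\<close> with the Frank--Wolfe gap \<open>G \<ge> F\<^sub>k (x k) - f x\<^sup>*\<close>,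
  and the parameter updates cost at most a relative \<open>O (1 / k)\<close>, which is negligible against
  \<open>alp k\<close>. Bounding \<open>norm (x - v)\<close> by the diameter gives \<open>E k \<longrightarrow> 0\<close>; so the multipliers
  eventually lie in \<open>A_set\<close>, the gradient of \<open>F\<^sub>k\<close> stays away from zero, and uniform convexity gives
  \<open>G \<ge> \<kappa> * norm (x - v) powr q\<close>. Then the quadratic term is absorbed by \<open>G / 2\<close> up to an error
  \<open>O (k powr (- (p - \<tau>) / \<mu>))\<close> (no error for \<open>q = 2\<close>), and this rate dominates the claimed one because
  \<open>\<mu> * (2 - \<mu>) \<le> 1\<close> and \<open>\<omega> \<le> p - \<tau>\<close>.
\<close>

subsection \<open>Gradients\<close>

text \<open>Since \<open>grad\<close> is a definite description, both existence and uniqueness are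
  at stake. Existence is the Riesz representation of the derivative, with
  \<open>adjoint f' 1\<close> as representing vector; uniqueness follows from uniqueness of
  derivatives.\<close>

lemma GDERIV_grad:
  fixes f :: "'a::euclidean_space \<Rightarrow> real"
  assumes "f differentiable at x"
  shows "GDERIV f x :> grad f x"
proof -
  obtain f' where f': "(f has_derivative f') (at x)"
    using assms by (auto simp: differentiable_def)
  then have "linear f'"
    by (simp add: has_derivative_bounded_linear bounded_linear.linear)
  then have "f' = (\<lambda>y. inner y (adjoint f' 1))"
    using adjoint_works[of f' _ 1] by (auto simp: inner_commute)
  with f' have D: "GDERIV f x :> adjoint f' 1"
    unfolding gderiv_def by metis
  show ?thesis
    unfolding grad_def
  proof (rule theI[where P = "\<lambda>D. GDERIV f x :> D", OF D])
    fix D assume "GDERIV f x :> D"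
    with D have "inner y D = inner y (adjoint f' 1)" for y
      unfolding gderiv_def by (metis has_derivative_unique)
    then show "D = adjoint f' 1"
      by (metis vector_eq_ldot)
  qed
qed

lemma grad_eqI:
  fixes f :: "'a::euclidean_space \<Rightarrow> real"
  assumes "GDERIV f x :> D"
  shows "grad f x = D"
proof -
  have "GDERIV f x :> grad f x"
    using assms by (intro GDERIV_grad) (auto simp: gderiv_def differentiable_def)
  then have "inner y (grad f x) = inner y D" for y
    using assms unfolding gderiv_def by (metis has_derivative_unique)
  then show ?thesis by (metis vector_eq_ldot)
qed

lemma GDERIV_segment:
  assumes "GDERIV f (x + t *\<^sub>R (y - x)) :> D"
  shows "((\<lambda>t. f (x + t *\<^sub>R (y - x))) has_field_derivative inner D (y - x)) (at t within S)"
proof -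
  have "((\<lambda>t. x + t *\<^sub>R (y - x)) has_derivative (\<lambda>h. h *\<^sub>R (y - x))) (at t within S)"
    by (auto intro!: derivative_eq_intros)
  moreover have "(f has_derivative (\<lambda>h. inner h D)) (at (x + t *\<^sub>R (y - x)))"
    using assms by (simp add: gderiv_def)
  ultimately have "((\<lambda>t. f (x + t *\<^sub>R (y - x))) has_derivative (\<lambda>h. inner (h *\<^sub>R (y - x)) D)) (at t within S)"
    by (rule has_derivative_compose)
  then show ?thesis
    by (simp add: has_field_derivative_def inner_commute mult_commute_abs)
qed

text \<open>Restriction to the line through \<open>x\<close> and \<open>y\<close> reduces the claim
  to the tangent inequality for a convex function of one real variable.\<close>

lemma convex_on_gradient_ineq:
  fixes f :: "'a::real_inner \<Rightarrow> real"
  assumes "convex_on UNIV f" "GDERIV f x :> D"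
  shows "f x + inner D (y - x) \<le> f y"
proof -
  let ?\<phi> = "\<lambda>t::real. f (x + t *\<^sub>R (y - x))"
  have "convex_on UNIV ?\<phi>"
  proof (rule convex_onI)
    fix t a b :: real assume t: "0 < t" "t < 1"
    have "x + ((1 - t) *\<^sub>R a + t *\<^sub>R b) *\<^sub>R (y - x)
        = (1 - t) *\<^sub>R (x + a *\<^sub>R (y - x)) + t *\<^sub>R (x + b *\<^sub>R (y - x))"
      by (simp add: algebra_simps)
    then show "?\<phi> ((1 - t) *\<^sub>R a + t *\<^sub>R b) \<le> (1 - t) * ?\<phi> a + t * ?\<phi> b"
      using convex_onD[OF assms(1)] t by simp
  qed simp
  moreover have "(?\<phi> has_field_derivative inner D (y - x)) (at 0)"
    using assms(2) by (intro GDERIV_segment) simp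
  ultimately have "?\<phi> 1 - ?\<phi> 0 \<ge> inner D (y - x) * (1 - 0)"
    by (intro convex_on_imp_above_tangent[of UNIV]) auto
  then show ?thesis by simp
qed

lemma gradient_mvt:
  fixes f :: "'a::real_inner \<Rightarrow> real"
  assumes "\<And>u. GDERIV f u :> df u"
  obtains t where "0 < t" "t < 1" "f y - f x = inner (df (x + t *\<^sub>R (y - x))) (y - x)"
proof -
  have "\<exists>t::real. 0 < t \<and> t < 1 \<and> f (x + 1 *\<^sub>R (y - x)) - f (x + 0 *\<^sub>R (y - x))
      = (1 - 0) * inner (df (x + t *\<^sub>R (y - x))) (y - x)"
    using assms by (intro MVT2 GDERIV_segment) auto
  then show thesis using that by auto
qed

text \<open>The constant \<^term>\<open>L\<close> instead of the sharp \<open>L / 2\<close> comes from using the mean value theorem.\<close>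

lemma lipschitz_gradient_descent:
  fixes f :: "'a::real_inner \<Rightarrow> real"
  assumes "\<And>u. GDERIV f u :> df u" "L-lipschitz_on S df" "convex S" "x \<in> S" "y \<in> S"
  shows "f y \<le> f x + inner (df x) (y - x) + L * (norm (y - x))\<^sup>2"
proof -
  obtain t where t: "0 < t" "t < 1" "f y - f x = inner (df (x + t *\<^sub>R (y - x))) (y - x)"
    using gradient_mvt[OF assms(1)] .
  let ?w = "x + t *\<^sub>R (y - x)"
  have "?w = (1 - t) *\<^sub>R x + t *\<^sub>R y" by (simp add: algebra_simps)
  then have w: "?w \<in> S" using assms(3-5) t by (simp add: convexD_alt)
  have L: "0 \<le> L" using assms(2) by (rule lipschitz_on_nonneg)
  have "f y - f x - inner (df x) (y - x) = inner (df ?w - df x) (y - x)"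
    using t by (simp add: inner_diff_left)
  also have "\<dots> \<le> norm (df ?w - df x) * norm (y - x)"
    by (rule norm_cauchy_schwarz)
  also have "\<dots> \<le> (L * norm (?w - x)) * norm (y - x)"
    using lipschitz_onD[OF assms(2) w assms(4)]
    by (intro mult_right_mono) (auto simp: dist_norm)
  also have "\<dots> \<le> (L * norm (y - x)) * norm (y - x)"
    using t L by (intro mult_right_mono mult_left_mono) (auto simp: mult_left_le_one_le)
  finally show ?thesis by (simp add: power2_eq_square)
qed

lemma gradient_bounded_lipschitz:
  fixes f :: "'a::real_inner \<Rightarrow> real"
  assumes "\<And>u. GDERIV f u :> df u" "\<And>u. u \<in> S \<Longrightarrow> norm (df u) \<le> M" "convex S" "x \<in> S" "y \<in> S"
  shows "\<bar>f y - f x\<bar> \<le> M * norm (y - x)"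
proof -
  obtain t where t: "0 < t" "t < 1" "f y - f x = inner (df (x + t *\<^sub>R (y - x))) (y - x)"
    using gradient_mvt[OF assms(1)] .
  let ?w = "x + t *\<^sub>R (y - x)"
  have "?w = (1 - t) *\<^sub>R x + t *\<^sub>R y" by (simp add: algebra_simps)
  then have "?w \<in> S" using assms(3-5) t by (simp add: convexD_alt)
  then have "norm (df ?w) * norm (y - x) \<le> M * norm (y - x)"
    using assms(2) by (intro mult_right_mono) auto
  then show ?thesis
    using t(3) Cauchy_Schwarz_ineq2[of "df ?w" "y - x"] by linarith
qed

subsection \<open>The augmented Lagrangian\<close>

lemma DERIV_max_zero_sq: "((\<lambda>t::real. (max t 0)\<^sup>2) has_field_derivative 2 * max t 0) (at t)"
proof -
  have "((\<lambda>t::real. t * max t 0) has_field_derivative 2 * max t 0) (at t)"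
  proof (cases t "0::real" rule: linorder_cases)
    case less
    have "((\<lambda>t::real. 0) has_field_derivative 2 * max t 0) (at t)"
      using less by simp
    then show ?thesis
      by (rule has_field_derivative_transform_within_open[where S = "{..<0}"]) (use less in auto)
  next
    case greater
    have "((\<lambda>t::real. t * t) has_field_derivative 2 * max t 0) (at t)"
      using greater by (auto intro!: derivative_eq_intros)
    then show ?thesis
      by (rule has_field_derivative_transform_within_open[where S = "{0<..}"]) (use greater in auto)
  next
    \<comment> \<open>At the kink the factored form \<open>t * max t 0\<close> has difference
      quotient \<open>max h 0\<close>, which tends to 0.\<close>
    case equal
    have "((\<lambda>h::real. max h 0) \<longlongrightarrow> max 0 0) (at 0)"
      by (intro tendsto_intros)
    moreover have "\<forall>\<^sub>F h::real in at 0. max h 0 = (h * max h 0) / h"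
      by (auto simp: eventually_at_filter)
    ultimately have "((\<lambda>h::real. (h * max h 0) / h) \<longlongrightarrow> max 0 0) (at 0)"
      by (rule Lim_transform_eventually)
    with equal show ?thesis by (simp add: has_field_derivative_iff)
  qed
  moreover have "(\<lambda>t::real. (max t 0)\<^sup>2) = (\<lambda>t. t * max t 0)"
    by (auto simp: max_def power2_eq_square fun_eq_iff)
  ultimately show ?thesis by simp
qed

text \<open>This is convexity of the squared positive part, whose derivative is
  \<open>2 * max s 0\<close>. For positive \<open>s\<close> the slack is a square plus a nonnegative
  multiple of \<open>max t 0 - t\<close>.\<close>

lemma max_zero_sq_lower: "(max s 0)\<^sup>2 + 2 * max s 0 * (t - s) \<le> (max t 0)\<^sup>2" for s t :: real
proof (cases "s \<le> 0")
  case False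
  then have "max s 0 = s" by simp
  moreover have "max t 0 * max t 0 = t * max t 0" by (auto simp: max_def)
  ultimately have "(max t 0)\<^sup>2 - ((max s 0)\<^sup>2 + 2 * max s 0 * (t - s)) = (max t 0 - s)\<^sup>2 + 2 * s * (max t 0 - t)"
    by (simp add: power2_eq_square algebra_simps)
  moreover have "\<dots> \<ge> 0" using False by simp
  ultimately show ?thesis by linarith
qed simp

text \<open>The matching quadratic upper bound reflects that the derivative
  \<open>2 * max s 0\<close> is 2-Lipschitz.\<close>

lemma max_zero_sq_upper: "(max t 0)\<^sup>2 \<le> (max s 0)\<^sup>2 + 2 * max s 0 * (t - s) + (t - s)\<^sup>2" for s t :: real
proof (cases "s \<le> 0")
  case True
  then have "\<bar>max t 0\<bar> \<le> \<bar>t - s\<bar>" by auto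
  then have "(max t 0)\<^sup>2 \<le> (t - s)\<^sup>2" by (simp only: abs_le_square_iff)
  then show ?thesis using True by simp
next
  case False
  then have "max s 0 = s" by simp
  then have "(max s 0)\<^sup>2 + 2 * max s 0 * (t - s) + (t - s)\<^sup>2 = t\<^sup>2"
    by (simp add: power2_eq_square algebra_simps)
  moreover have "(max t 0)\<^sup>2 \<le> t\<^sup>2" by (auto simp: max_def)
  ultimately show ?thesis by simp
qed

definition psi :: "real \<Rightarrow> real \<Rightarrow> real \<Rightarrow> real" where
  "psi l t z = l / 2 * ((max (t + z / l) 0)\<^sup>2 - (z / l)\<^sup>2)"

lemma Psi_eq_sum_psi: "Psi g l x z = (\<Sum>i\<in>UNIV. psi l (g x $ i) (z $ i))"
  by (simp add: Psi_def psi_def sum_distrib_left)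

text \<open>The next three lemmas express that \<^term>\<open>psi l t z\<close> is the minimum of \<open>z * u + l / 2 * u\<^sup>2\<close>
  over \<open>u \<ge> t\<close>.\<close>

lemma psi_quadratic: "0 < l \<Longrightarrow> z * u + l / 2 * u\<^sup>2 = l / 2 * ((u + z / l)\<^sup>2 - (z / l)\<^sup>2)" for l :: real
  by (simp add: power2_eq_square field_simps)

lemma psi_le_quadratic:
  assumes "0 < l" "t \<le> u"
  shows "psi l t z \<le> z * u + l / 2 * u\<^sup>2"
proof -
  have "\<bar>max (t + z / l) 0\<bar> \<le> \<bar>u + z / l\<bar>" using assms by auto
  then have "(max (t + z / l) 0)\<^sup>2 \<le> (u + z / l)\<^sup>2" by (simp only: abs_le_square_iff)
  then show ?thesis unfolding psi_quadratic[OF assms(1)] psi_def using assms(1) by simp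
qed

lemma psi_eq_quadratic:
  assumes "0 < l" and u: "u = max (- (z / l)) t"
  shows "psi l t z = z * u + l / 2 * u\<^sup>2"
proof -
  have "u + z / l = max (t + z / l) 0" by (auto simp: u max_def)
  then show ?thesis unfolding psi_quadratic[OF assms(1)] psi_def by simp
qed

text \<open>The dual increment \<open>u\<close> attains the minimum for the old parameters and,
  since \<open>u \<ge> t\<close>, is still admissible for the new ones. Using it as a test point
  there leaves only the change of the coefficients, a multiple of \<open>u\<^sup>2\<close>.\<close>

lemma psi_parameter_change:
  assumes "0 < l" "l \<le> l'" "0 \<le> s" "0 \<le> z" and u: "u = max (- (z / l)) t"
  shows "psi l' t (z + s * u) \<le> psi l t z + (s + (l' - l) / 2) * ((max t 0)\<^sup>2 + (z / l)\<^sup>2)"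
proof -
  have "psi l' t (z + s * u) \<le> (z + s * u) * u + l' / 2 * u\<^sup>2"
    using assms by (intro psi_le_quadratic) auto
  also have "\<dots> = psi l t z + (s + (l' - l) / 2) * u\<^sup>2"
    unfolding psi_eq_quadratic[OF assms(1) u] by (simp add: power2_eq_square field_simps)
  \<comment> \<open>If \<open>t \<ge> 0\<close> then \<open>u = t\<close>; otherwise
    \<open>u\<close> lies between \<open>- (z / l)\<close> and 0.\<close>
  also have "u\<^sup>2 \<le> (max t 0)\<^sup>2 + (z / l)\<^sup>2"
  proof (cases "t \<ge> 0")
    case True
    then show ?thesis using assms(1,4) by (simp add: u max_def)
  next
    case False
    then have "\<bar>u\<bar> \<le> \<bar>z / l\<bar>" using assms(1,4) by (auto simp: u)
    then have "u\<^sup>2 \<le> (z / l)\<^sup>2" by (simp only: abs_le_square_iff)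
    then show ?thesis by (simp add: add_increasing)
  qed
  finally show ?thesis using assms by (simp add: mult_left_mono)
qed

lemma psi_nonpos:
  assumes "0 < l" "0 \<le> z" "t \<le> 0"
  shows "psi l t z \<le> 0"
  using psi_le_quadratic[of l t 0 z] assms by simp

text \<open>Dropping the nonnegative shift \<open>z / l\<close> inside the positive part keeps the
  full penalty on the violation; for bounded multipliers the loss is of order
  \<open>1 / l\<close>.\<close>

lemma psi_lower:
  assumes "0 < l" "0 \<le> z"
  shows "l / 2 * (max t 0)\<^sup>2 - z\<^sup>2 / (2 * l) \<le> psi l t z"
proof -
  have "0 \<le> z / l" using assms by simp
  then have "\<bar>max t 0\<bar> \<le> \<bar>max (t + z / l) 0\<bar>" by linarith
  then have "(max t 0)\<^sup>2 \<le> (max (t + z / l) 0)\<^sup>2" by (simp only: abs_le_square_iff)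
  then have "l / 2 * ((max t 0)\<^sup>2 - (z / l)\<^sup>2) \<le> psi l t z"
    unfolding psi_def using assms(1) by (intro mult_left_mono) auto
  moreover have "l / 2 * ((max t 0)\<^sup>2 - (z / l)\<^sup>2) = l / 2 * (max t 0)\<^sup>2 - z\<^sup>2 / (2 * l)"
    using assms(1) by (simp add: power2_eq_square field_simps)
  ultimately show ?thesis by simp
qed

lemma psi_tangent:
  assumes "0 < l"
  shows "psi l s z + l * max (s + z / l) 0 * (t - s) \<le> psi l t z"
proof -
  have "l / 2 * ((max (s + z / l) 0)\<^sup>2 + 2 * max (s + z / l) 0 * ((t + z / l) - (s + z / l)))
      \<le> l / 2 * (max (t + z / l) 0)\<^sup>2"
    using assms by (intro mult_left_mono max_zero_sq_lower) auto
  then show ?thesis by (simp add: psi_def algebra_simps)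
qed

lemma psi_descent:
  assumes "0 < l"
  shows "psi l t z \<le> psi l s z + l * max (s + z / l) 0 * (t - s) + l / 2 * (t - s)\<^sup>2"
proof -
  have "l / 2 * (max (t + z / l) 0)\<^sup>2
      \<le> l / 2 * ((max (s + z / l) 0)\<^sup>2 + 2 * max (s + z / l) 0 * ((t + z / l) - (s + z / l))
          + ((t + z / l) - (s + z / l))\<^sup>2)"
    using assms by (intro mult_left_mono max_zero_sq_upper) auto
  then show ?thesis by (simp add: psi_def algebra_simps)
qed

text \<open>Componentwise, this is the derivative of \<open>psi\<close> in the constraint value: the
  first-order multiplier estimate of the augmented Lagrangian method. With it in place of
  \<open>z\<close>, the gradient of \<open>F_aug\<close> becomes that of the ordinary
  Lagrangian.\<close>

definition multiplier_estimate :: "(real ^ 'n \<Rightarrow> real ^ 'm) \<Rightarrow> real \<Rightarrow> real ^ 'n \<Rightarrow> real ^ 'm \<Rightarrow> real ^ 'm" where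
  "multiplier_estimate g l x z = (\<chi> i. l * max (g x $ i + z $ i / l) 0)"

text \<open>This is the vector whose norm hypothesis (b) keeps away from zero.\<close>

definition lagrangian_grad ::
  "(real ^ 'n \<Rightarrow> real) \<Rightarrow> (real ^ 'n \<Rightarrow> real ^ 'm) \<Rightarrow> real ^ 'n \<Rightarrow> real ^ 'm \<Rightarrow> real ^ 'n" where
  "lagrangian_grad f g x w = grad f x + (\<Sum>i\<in>UNIV. (w $ i) *\<^sub>R grad (\<lambda>y. g y $ i) x)"

lemma GDERIV_sum:
  assumes "finite I" "\<And>i. i \<in> I \<Longrightarrow> GDERIV (f i) x :> D i"
  shows "GDERIV (\<lambda>x. \<Sum>i\<in>I. f i x) x :> (\<Sum>i\<in>I. D i)"
  using assms unfolding gderiv_def inner_sum_right by (auto intro!: has_derivative_sum)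

lemma grad_F_aug:
  fixes f :: "real ^ 'n \<Rightarrow> real" and g :: "real ^ 'n \<Rightarrow> real ^ 'm"
  assumes "\<And>y. f differentiable at y" "\<And>i y. (\<lambda>y. g y $ i) differentiable at y" "0 < l"
  shows "grad (\<lambda>y. F_aug f g l y z) x = lagrangian_grad f g x (multiplier_estimate g l x z)"
proof (rule grad_eqI)
  have "GDERIV (\<lambda>y. psi l (g y $ i) (z $ i)) x
          :> (multiplier_estimate g l x z $ i) *\<^sub>R grad (\<lambda>y. g y $ i) x" for i
  proof -
    have "((\<lambda>t. (max t 0)\<^sup>2) has_field_derivative 2 * max (t + z $ i / l) 0) (at (t + z $ i / l))" for t
      by (rule DERIV_max_zero_sq)
    then have "((\<lambda>t. (max (t + z $ i / l) 0)\<^sup>2) has_field_derivative 2 * max (t + z $ i / l) 0) (at t)" for t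
      by (simp add: DERIV_shift)
    then have "((\<lambda>t. l / 2 * ((max (t + z $ i / l) 0)\<^sup>2 - (z $ i / l)\<^sup>2)) has_field_derivative
        l / 2 * (2 * max (t + z $ i / l) 0 - 0)) (at t)" for t
      by (intro DERIV_cmult DERIV_diff DERIV_const)
    then have "((\<lambda>t. psi l t (z $ i)) has_field_derivative multiplier_estimate g l x z $ i) (at (g x $ i))"
      by (simp add: psi_def multiplier_estimate_def)
    with GDERIV_grad[OF assms(2)] show ?thesis by (rule GDERIV_DERIV_compose)
  qed
  then show "GDERIV (\<lambda>y. F_aug f g l y z) x :> lagrangian_grad f g x (multiplier_estimate g l x z)"
    unfolding F_aug_def Psi_eq_sum_psi lagrangian_grad_def
    by (intro GDERIV_add GDERIV_sum GDERIV_grad assms) auto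
qed

text \<open>The penalty is a convex nondecreasing function of convex constraints. Its monotonicity
  enters as nonnegativity of the multiplier estimate, which allows the tangent inequality of each
  constraint to be scaled and inserted into \<open>psi_tangent\<close>.\<close>

lemma F_aug_convex_lower:
  fixes f :: "real ^ 'n \<Rightarrow> real" and g :: "real ^ 'n \<Rightarrow> real ^ 'm"
  assumes f: "convex_on UNIV f" "\<And>y. f differentiable at y"
    and g: "\<And>i. convex_on UNIV (\<lambda>y. g y $ i)" "\<And>i y. (\<lambda>y. g y $ i) differentiable at y"
    and l: "0 < l"
  shows "F_aug f g l x z + inner (lagrangian_grad f g x (multiplier_estimate g l x z)) (y - x)
    \<le> F_aug f g l y z"
proof -
  let ?w = "multiplier_estimate g l x z"
  have "psi l (g x $ i) (z $ i) + ?w $ i * inner (grad (\<lambda>y. g y $ i) x) (y - x)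
      \<le> psi l (g y $ i) (z $ i)" for i
  proof -
    have "inner (grad (\<lambda>y. g y $ i) x) (y - x) \<le> g y $ i - g x $ i"
      using convex_on_gradient_ineq[OF g(1) GDERIV_grad[OF g(2)], of x i y] by simp
    then have "?w $ i * inner (grad (\<lambda>y. g y $ i) x) (y - x) \<le> ?w $ i * (g y $ i - g x $ i)"
      using l by (intro mult_left_mono) (auto simp: multiplier_estimate_def)
    then show ?thesis
      using psi_tangent[OF l, of "g x $ i" "z $ i" "g y $ i"] by (simp add: multiplier_estimate_def)
  qed
  then have "(\<Sum>i\<in>UNIV. psi l (g x $ i) (z $ i) + ?w $ i * inner (grad (\<lambda>y. g y $ i) x) (y - x))
      \<le> (\<Sum>i\<in>UNIV. psi l (g y $ i) (z $ i))"
    by (rule sum_mono)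
  moreover have "f x + inner (grad f x) (y - x) \<le> f y"
    by (rule convex_on_gradient_ineq[OF f(1) GDERIV_grad[OF f(2)]])
  ultimately show ?thesis
    by (simp add: F_aug_def Psi_eq_sum_psi lagrangian_grad_def inner_add_left inner_sum_left sum.distrib)
qed

text \<open>The composition with \<open>psi\<close> has two sources of curvature: that of each
  constraint, weighted by its multiplier estimate, and that of \<open>psi\<close>, which acts on the
  squared change of the constraint value and so brings in \<open>M\<^sup>2\<close>. Both grow at
  most like \<open>l\<close> when the multipliers are bounded and \<open>S\<close> is
  compact.\<close>

lemma F_aug_descent:
  fixes f :: "real ^ 'n \<Rightarrow> real" and g :: "real ^ 'n \<Rightarrow> real ^ 'm"
  assumes f: "\<And>y. f differentiable at y" "Lf-lipschitz_on S (grad f)"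
    and g: "\<And>i y. (\<lambda>y. g y $ i) differentiable at y"
      "\<And>i. (Lg i)-lipschitz_on S (grad (\<lambda>y. g y $ i))"
    and M: "\<And>i u. u \<in> S \<Longrightarrow> norm (grad (\<lambda>y. g y $ i) u) \<le> M"
    and l: "0 < l" and S: "convex S" "x \<in> S" "y \<in> S"
  shows "F_aug f g l y z \<le> F_aug f g l x z
    + inner (lagrangian_grad f g x (multiplier_estimate g l x z)) (y - x)
    + (Lf + (\<Sum>i\<in>UNIV. multiplier_estimate g l x z $ i * Lg i + l / 2 * M\<^sup>2)) * (norm (y - x))\<^sup>2"
proof -
  let ?w = "multiplier_estimate g l x z"
  have "psi l (g y $ i) (z $ i) \<le> psi l (g x $ i) (z $ i)
      + ?w $ i * inner (grad (\<lambda>y. g y $ i) x) (y - x)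
      + (?w $ i * Lg i + l / 2 * M\<^sup>2) * (norm (y - x))\<^sup>2" for i
  proof -
    have "g y $ i - g x $ i \<le> inner (grad (\<lambda>y. g y $ i) x) (y - x) + Lg i * (norm (y - x))\<^sup>2"
      using lipschitz_gradient_descent[OF GDERIV_grad[OF g(1)] g(2) S, of i] by simp
    then have "?w $ i * (g y $ i - g x $ i)
        \<le> ?w $ i * (inner (grad (\<lambda>y. g y $ i) x) (y - x) + Lg i * (norm (y - x))\<^sup>2)"
      using l by (intro mult_left_mono) (auto simp: multiplier_estimate_def)
    moreover have "\<bar>g y $ i - g x $ i\<bar>\<^sup>2 \<le> (M * norm (y - x))\<^sup>2"
      using gradient_bounded_lipschitz[OF GDERIV_grad[OF g(1)] M S, of i] by (intro power_mono) auto
    then have "l / 2 * (g y $ i - g x $ i)\<^sup>2 \<le> l / 2 * (M\<^sup>2 * (norm (y - x))\<^sup>2)"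
      using l by (intro mult_left_mono) (auto simp: power_mult_distrib)
    ultimately show ?thesis
      using psi_descent[OF l, of "g y $ i" "z $ i" "g x $ i"]
      by (simp add: multiplier_estimate_def algebra_simps)
  qed
  then have "(\<Sum>i\<in>UNIV. psi l (g y $ i) (z $ i)) \<le> (\<Sum>i\<in>UNIV. psi l (g x $ i) (z $ i)
      + ?w $ i * inner (grad (\<lambda>y. g y $ i) x) (y - x)
      + (?w $ i * Lg i + l / 2 * M\<^sup>2) * (norm (y - x))\<^sup>2)"
    by (intro sum_mono)
  moreover have "f y \<le> f x + inner (grad f x) (y - x) + Lf * (norm (y - x))\<^sup>2"
    by (rule lipschitz_gradient_descent[OF GDERIV_grad[OF f(1)] f(2) S])
  ultimately show ?thesis
    by (simp add: F_aug_def Psi_eq_sum_psi lagrangian_grad_def inner_add_left inner_sum_left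
        sum.distrib distrib_right sum_distrib_right)
qed

lemma norm_pos_part_sq: "(norm (pos_part a))\<^sup>2 = (\<Sum>i\<in>UNIV. (max (a $ i) 0)\<^sup>2)"
  unfolding power2_norm_eq_inner inner_vec_def by (simp add: pos_part_def power2_eq_square)

lemma F_aug_parameter_change:
  fixes f :: "real ^ 'n \<Rightarrow> real" and g :: "real ^ 'n \<Rightarrow> real ^ 'm"
  assumes "0 < l" "l \<le> l'" "0 \<le> s" "0 \<le> z"
  shows "F_aug f g l' x (z + s *\<^sub>R (\<chi> i. max (- (z $ i / l)) (g x $ i)))
    \<le> F_aug f g l x z + (s + (l' - l) / 2) * ((norm (pos_part (g x)))\<^sup>2 + (norm z)\<^sup>2 / l\<^sup>2)"
proof -
  have "(\<Sum>i\<in>UNIV. psi l' (g x $ i) (z $ i + s * max (- (z $ i / l)) (g x $ i)))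
      \<le> (\<Sum>i\<in>UNIV. psi l (g x $ i) (z $ i)
          + (s + (l' - l) / 2) * ((max (g x $ i) 0)\<^sup>2 + (z $ i / l)\<^sup>2))"
    using assms by (intro sum_mono psi_parameter_change) (auto simp: less_eq_vec_def)
  also have "\<dots> = (\<Sum>i\<in>UNIV. psi l (g x $ i) (z $ i))
      + (s + (l' - l) / 2) * ((\<Sum>i\<in>UNIV. (max (g x $ i) 0)\<^sup>2) + (\<Sum>i\<in>UNIV. (z $ i / l)\<^sup>2))"
    by (simp add: sum.distrib sum_distrib_left[symmetric])
  also have "(\<Sum>i\<in>UNIV. (z $ i / l)\<^sup>2) = (norm z)\<^sup>2 / l\<^sup>2"
    unfolding power2_norm_eq_inner inner_vec_def
    by (simp add: power_divide sum_divide_distrib power2_eq_square)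
  finally show ?thesis
    by (simp add: F_aug_def Psi_eq_sum_psi norm_pos_part_sq)
qed

lemma F_aug_feasible_le:
  fixes f :: "real ^ 'n \<Rightarrow> real" and g :: "real ^ 'n \<Rightarrow> real ^ 'm"
  assumes "0 < l" "0 \<le> z" "g x \<le> 0"
  shows "F_aug f g l x z \<le> f x"
proof -
  have "(\<Sum>i\<in>UNIV. psi l (g x $ i) (z $ i)) \<le> 0"
    using assms by (intro sum_nonpos psi_nonpos) (auto simp: less_eq_vec_def)
  then show ?thesis by (simp add: F_aug_def Psi_eq_sum_psi)
qed

lemma F_aug_lower:
  fixes f :: "real ^ 'n \<Rightarrow> real" and g :: "real ^ 'n \<Rightarrow> real ^ 'm"
  assumes "0 < l" "0 \<le> z"
  shows "f x + l / 2 * (norm (pos_part (g x)))\<^sup>2 - (norm z)\<^sup>2 / (2 * l) \<le> F_aug f g l x z"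
proof -
  have "(\<Sum>i\<in>UNIV. l / 2 * (max (g x $ i) 0)\<^sup>2 - (z $ i)\<^sup>2 / (2 * l))
      \<le> (\<Sum>i\<in>UNIV. psi l (g x $ i) (z $ i))"
    using assms by (intro sum_mono psi_lower) (auto simp: less_eq_vec_def)
  also have "(\<Sum>i\<in>UNIV. l / 2 * (max (g x $ i) 0)\<^sup>2 - (z $ i)\<^sup>2 / (2 * l))
      = l / 2 * (norm (pos_part (g x)))\<^sup>2 - (norm z)\<^sup>2 / (2 * l)"
    unfolding norm_pos_part_sq power2_norm_eq_inner[of z] inner_vec_def
    by (simp add: sum_subtractf sum_distrib_left sum_divide_distrib power2_eq_square)
  finally show ?thesis by (simp add: F_aug_def Psi_eq_sum_psi)
qed

lemma inner_le_norm_pos_part: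
  assumes "0 \<le> w"
  shows "inner w a \<le> norm w * norm (pos_part a)"
proof -
  have "inner w a \<le> inner w (pos_part a)"
    using assms unfolding inner_vec_def
    by (intro sum_mono) (auto simp: pos_part_def less_eq_vec_def intro!: mult_left_mono)
  then show ?thesis using norm_cauchy_schwarz[of w "pos_part a"] by linarith
qed

subsection \<open>Recursions with polynomial rates\<close>

text \<open>The contraction factor \<open>1 - a k\<^sup>-\<^sup>p\<close> with \<open>p < 1\<close> beats every polynomial decay of the
  forcing term, since \<open>(k / (k + 1))\<^sup>r \<ge> 1 - r / k\<close>.\<close>

lemma powr_recursion_bound:
  fixes D :: "nat \<Rightarrow> real"
  assumes a: "0 < a" and p: "0 < p" "p < 1" and r: "0 \<le> r" and b: "0 \<le> b"
    and D: "\<And>k. 0 \<le> D k"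
    and rec: "\<forall>\<^sub>F k in sequentially.
      D (Suc k) \<le> (1 - a * real k powr -p) * D k + b * (real k powr -p * real k powr -r)"
  shows "\<exists>M\<ge>0. \<forall>\<^sub>F k in sequentially. D k \<le> M * real k powr -r"
proof -
  have lim: "((\<lambda>k. real k powr -t) \<longlongrightarrow> 0) sequentially" if "t > 0" for t
    using that by (intro tendsto_neg_powr filterlim_real_sequentially) auto
  \<comment> \<open>This threshold makes \<open>r / k\<close> at most half of the contraction
    \<open>a * real k powr -p\<close>; the next one makes the contraction factor
    nonnegative.\<close>
  have "\<forall>\<^sub>F k in sequentially. real k powr -(1 - p) < a / (2 * (r + 1))"
    using lim[of "1 - p"] a p r by (intro order_tendstoD) auto
  moreover have "\<forall>\<^sub>F k in sequentially. real k powr -p < 1 / a"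
    using lim[of p] a p by (intro order_tendstoD) auto
  ultimately have "\<forall>\<^sub>F k in sequentially.
      D (Suc k) \<le> (1 - a * real k powr -p) * D k + b * (real k powr -p * real k powr -r) \<and>
      real k powr -(1 - p) < a / (2 * (r + 1)) \<and> real k powr -p < 1 / a \<and> 1 \<le> k"
    using rec eventually_ge_at_top[of 1] by eventually_elim auto
  then obtain K where K: "\<And>k. k \<ge> K \<Longrightarrow>
      D (Suc k) \<le> (1 - a * real k powr -p) * D k + b * (real k powr -p * real k powr -r)"
    "\<And>k. k \<ge> K \<Longrightarrow> real k powr -(1 - p) < a / (2 * (r + 1))"
    "\<And>k. k \<ge> K \<Longrightarrow> real k powr -p < 1 / a" "\<And>k. k \<ge> K \<Longrightarrow> 1 \<le> k"
    unfolding eventually_sequentially by blast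
  have pos: "k > 0" if "k \<ge> K" for k using K(4)[OF that] by simp
  define M where "M = max (2 * b / a) (D K / real K powr -r)"
  have M: "2 * b / a \<le> M" "D K / real K powr -r \<le> M" "0 \<le> M"
    using a b D[of K] by (auto simp: M_def le_max_iff_disj)
  have "D k \<le> M * real k powr -r" if "k \<ge> K" for k
    using that
  proof (induction k rule: dec_induct)
    case base
    then show ?case using M(2) pos[of K] by (simp add: divide_le_eq)
  next
    case (step k)
    let ?P = "real k powr -p" and ?R = "real k powr -r"
    have k: "real k \<ge> 1" using K(4)[OF step(1)] by simp
    have "real k powr -(1 - p) * ?P = real k powr -1"
      using powr_add[of "real k" "-(1 - p)" "-p"] by simp
    also have "\<dots> = 1 / real k" using k by (simp only: powr_minus_divide) simp
    finally have "r * (1 / real k) = r * (real k powr -(1 - p) * ?P)" by simp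
    also have "\<dots> \<le> (r + 1) * (a / (2 * (r + 1)) * ?P)"
      using K(2)[OF step(1)] r by (intro mult_mono mult_right_mono) auto
    also have "\<dots> = a / 2 * ?P" using r by (simp add: divide_simps)
    finally have rk: "r * (1 / real k) \<le> a / 2 * ?P" .
    have "1 - r * (1 / real k) \<le> exp (- r * (1 / real k))"
      using exp_ge_add_one_self[of "- r * (1 / real k)"] by simp
    also have "\<dots> \<le> exp (- r * ln (1 + 1 / real k))"
      using mult_left_mono[OF ln_add_one_self_le_self[of "1 / real k"] r] by simp
    also have "\<dots> = (1 + 1 / real k) powr -r"
      using k by (simp add: powr_def add_nonneg_eq_0_iff)
    finally have "(1 - a / 2 * ?P) * ?R \<le> (1 + 1 / real k) powr -r * ?R"
      using rk by (intro mult_right_mono) auto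
    also have "\<dots> = real (Suc k) powr -r"
    proof -
      have "(1 + 1 / real k) * real k = real (Suc k)" using k by (simp add: distrib_right)
      then show ?thesis by (simp only: powr_mult[symmetric])
    qed
    finally have S: "(1 - a / 2 * ?P) * ?R \<le> real (Suc k) powr -r" .
    have aP: "0 \<le> 1 - a * ?P" using K(3)[OF step(1)] a by (simp add: field_simps)
    have "b \<le> a / 2 * M" using M(1) a by (simp add: field_simps)
    have "D (Suc k) \<le> (1 - a * ?P) * D k + b * (?P * ?R)" using K(1)[OF step(1)] .
    also have "\<dots> \<le> (1 - a * ?P) * (M * ?R) + (a / 2 * M) * (?P * ?R)"
      using aP step.IH \<open>b \<le> a / 2 * M\<close> by (intro add_mono mult_left_mono mult_right_mono) auto
    also have "\<dots> = M * ((1 - a / 2 * ?P) * ?R)" by (simp add: algebra_simps)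
    also have "\<dots> \<le> M * real (Suc k) powr -r" using S M(3) by (intro mult_left_mono)
    finally show ?case .
  qed
  then show ?thesis using M(3) unfolding eventually_sequentially by blast
qed

text \<open>Here \<open>D\<close> is the energy, \<open>P\<close> the energy after the primal step
  only, and \<open>N\<close> the squared violation. As \<open>p < 1\<close>, the parameter cost
  \<open>d\<close> is eventually a small multiple of \<open>alp * lam\<close>, so
  \<open>d * N\<close> is at most \<open>alp / 4 * P\<close> and half of the contraction survives.
  The term with \<open>E\<close> costs \<open>alp / lam\<close> up to a constant, which is
  admissible because \<open>r \<le> \<tau>\<close>.\<close>

lemma penalty_energy_rate:
  fixes D P N lam alp d e :: "nat \<Rightarrow> real" and E :: real
  assumes exps: "0 < p" "p < 1" "0 \<le> r" "r \<le> \<tau>"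
    and alp: "0 < a" "0 \<le> A" "\<And>k. 0 \<le> alp k" "\<And>k. alp k \<le> 1"
      "\<forall>\<^sub>F k in sequentially. a * real k powr -p \<le> alp k"
      "\<forall>\<^sub>F k in sequentially. alp k \<le> A * real k powr -p"
    and lam: "0 < c" "\<And>k. 0 < lam k" "\<forall>\<^sub>F k in sequentially. c * real k powr \<tau> \<le> lam k"
    and d: "\<And>k. 0 \<le> d k" "0 \<le> c'" "\<forall>\<^sub>F k in sequentially. d k \<le> c' * real k powr -(1 - \<tau>)"
    and D: "\<And>k. 0 \<le> D k" and E: "0 \<le> E"
    and N: "\<And>k. 0 \<le> N k" "\<And>k. lam k / 4 * N k \<le> P k"
    and step: "\<And>k. D (Suc k) \<le> P k + d k * (N k + E / (lam k)\<^sup>2)"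
    and P: "\<forall>\<^sub>F k in sequentially. P k \<le> (1 - alp k / 2) * D k + alp k * e k"
    and e: "0 \<le> b" "\<forall>\<^sub>F k in sequentially. e k \<le> b * real k powr -r"
  shows "\<exists>M\<ge>0. \<forall>\<^sub>F k in sequentially. D k \<le> M * real k powr -r"
proof (rule powr_recursion_bound[where a = "a / 4" and p = p and b = "A * (2 * b + E / c)"])
  have "((\<lambda>k. real k powr -(1 - p)) \<longlongrightarrow> 0) sequentially"
    using exps by (intro tendsto_neg_powr filterlim_real_sequentially) auto
  then have "\<forall>\<^sub>F k in sequentially. real k powr -(1 - p) < a * c / (16 * (c' + 1))"
    using alp(1) lam(1) d(2) by (intro order_tendstoD) auto
  then show "\<forall>\<^sub>F k in sequentially. D (Suc k) \<le> (1 - a / 4 * real k powr -p) * D k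
      + A * (2 * b + E / c) * (real k powr -p * real k powr -r)"
    using alp(5,6) lam(3) d(3) P e(2) eventually_ge_at_top[of 1]
  proof eventually_elim
    case (elim k)
    have k: "real k \<ge> 1" using elim by simp
    let ?R = "real k powr -r"
    have "d k \<le> c' * real k powr -(1 - \<tau>)" by fact
    \<comment> \<open>The first factor falls below the threshold chosen above, the second is
      dominated by \<open>alp k\<close> and the third by \<open>lam k\<close>. The
      \<open>c' + 1\<close> in that threshold avoids division by zero.\<close>
    also have "real k powr -(1 - \<tau>) = real k powr (-(1 - p) + -p + \<tau>)"
      by (rule arg_cong[where f = "\<lambda>t. real k powr t"]) simp
    also have "\<dots> = real k powr -(1 - p) * real k powr -p * real k powr \<tau>"
      by (simp only: powr_add)
    also have "c' * \<dots> \<le> (c' + 1) * (a * c / (16 * (c' + 1)) * real k powr -p * real k powr \<tau>)"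
      using elim(1) d(2) by (intro mult_mono mult_right_mono) auto
    also have "\<dots> = (a * real k powr -p) * (c * real k powr \<tau>) / 16"
      using d(2) by (simp add: divide_simps)
    also have "\<dots> \<le> alp k * lam k / 16"
      using elim alp(1) lam(1) alp(3)[of k] by (intro divide_right_mono mult_mono) auto
    finally have dk: "d k \<le> alp k * lam k / 16" .
    have P0: "0 \<le> P k"
      using N(1)[of k] N(2)[of k] lam(2)[of k] by (smt (verit) divide_pos_pos mult_nonneg_nonneg)
    have "d k * N k \<le> (alp k * lam k / 16) * N k"
      using dk N(1) by (intro mult_right_mono) auto
    also have "\<dots> = alp k / 4 * (lam k / 4 * N k)" by simp
    also have "\<dots> \<le> alp k / 4 * P k" using N(2) alp(3)[of k] by (intro mult_left_mono) auto
    finally have dN: "d k * N k \<le> alp k / 4 * P k" .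
    have "1 / lam k \<le> 1 / (c * real k powr \<tau>)"
      using elim lam(1) k by (intro divide_left_mono) (auto intro!: mult_pos_pos lam(2))
    also have "\<dots> = real k powr -\<tau> / c" by (simp add: powr_minus field_simps)
    also have "\<dots> \<le> ?R / c" using exps k lam(1) by (intro divide_right_mono powr_mono) auto
    finally have il: "1 / lam k \<le> ?R / c" .
    have "d k * (E / (lam k)\<^sup>2) \<le> (alp k * lam k / 16) * (E / (lam k)\<^sup>2)"
      using dk E by (intro mult_right_mono) auto
    also have "\<dots> = alp k * E / 16 * (1 / lam k)" using lam(2)[of k] by (simp add: power2_eq_square)
    also have "\<dots> \<le> alp k * E * (?R / c)"
      using il E alp(3)[of k] lam(2)[of k] by (intro mult_mono) (auto simp: less_imp_le)
    finally have dE: "d k * (E / (lam k)\<^sup>2) \<le> alp k * E * (?R / c)" .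
    have "P k * (1 + alp k / 4) \<le> ((1 - alp k / 2) * D k + alp k * (b * ?R)) * (1 + alp k / 4)"
    proof (intro mult_right_mono)
      have "alp k * e k \<le> alp k * (b * ?R)" using elim alp(3)[of k] by (intro mult_left_mono) auto
      then show "P k \<le> (1 - alp k / 2) * D k + alp k * (b * ?R)" using elim by linarith
    qed (use alp(3)[of k] in auto)
    also have "\<dots> = (1 - alp k / 2) * (1 + alp k / 4) * D k + (alp k * (b * ?R)) * (1 + alp k / 4)"
      by (simp add: algebra_simps)
    also have "\<dots> \<le> (1 - alp k / 4) * D k + (alp k * (b * ?R)) * 2"
    proof (intro add_mono mult_right_mono mult_left_mono)
      show "(1 - alp k / 2) * (1 + alp k / 4) \<le> 1 - alp k / 4"
        by (simp add: algebra_simps)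
      show "1 + alp k / 4 \<le> 2" using alp(4)[of k] by simp
      show "0 \<le> alp k * (b * ?R)" using alp(3)[of k] e(1) by simp
    qed (rule D)
    finally have "D (Suc k) \<le> (1 - alp k / 4) * D k + (alp k * (b * ?R)) * 2 + alp k * E * (?R / c)"
      using step[of k] dN dE by (simp add: algebra_simps)
    also have "\<dots> = (1 - alp k / 4) * D k + alp k * ((2 * b + E / c) * ?R)"
      by (simp add: algebra_simps)
    also have "\<dots> \<le> (1 - a / 4 * real k powr -p) * D k + (A * real k powr -p) * ((2 * b + E / c) * ?R)"
      using elim D[of k] e(1) E lam(1) by (intro add_mono mult_right_mono) auto
    finally show ?case by (simp add: algebra_simps)
  qed
qed (use assms in auto)

lemma bigoE_nonneg:
  fixes f g :: "nat \<Rightarrow> real"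
  assumes "f \<in> O(g)" "\<And>k. 0 \<le> f k" "\<And>k. 0 \<le> g k"
  obtains c where "0 < c" "\<forall>\<^sub>F k in sequentially. f k \<le> c * g k"
  using assms(1) by (rule landau_o.bigE) (use assms(2,3) that in simp)

lemma bigomegaE_nonneg:
  fixes f g :: "nat \<Rightarrow> real"
  assumes "f \<in> \<Omega>(g)" "\<And>k. 0 \<le> f k" "\<And>k. 0 \<le> g k"
  obtains c where "0 < c" "\<forall>\<^sub>F k in sequentially. c * g k \<le> f k"
  using assms(1) by (rule landau_omega.bigE) (use assms(2,3) that in simp)

text \<open>A Young-type inequality by cases: if half of \<open>G\<close> does not cover the left
  side, then \<open>\<kappa> * d powr q < 2 * \<beta> * d\<^sup>2\<close>, which bounds
  \<open>d\<close> by a power of \<open>\<beta>\<close>.\<close>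

lemma powr_absorb:
  fixes \<beta> \<kappa> d G q :: real
  assumes "2 < q" "0 < \<kappa>" "0 \<le> \<beta>" "0 \<le> d" and gap: "\<kappa> * d powr q \<le> G"
  shows "\<beta> * d\<^sup>2 \<le> G / 2 + (2 / \<kappa>) powr (2 / (q - 2)) * \<beta> powr (q / (q - 2))"
proof (cases "\<beta> * d\<^sup>2 \<le> G / 2")
  case True
  then show ?thesis by (simp add: add_increasing2)
next
  case False
  have "0 \<le> \<kappa> * d powr q" using assms by simp
  with gap have G: "0 \<le> G" by linarith
  with False assms have d: "0 < d" and \<beta>: "0 < \<beta>"
    by (cases "d = 0"; cases "\<beta> = 0"; simp)+
  have "d powr (q - 2) * d\<^sup>2 = d powr q"
    using d by (simp add: powr_add[symmetric] flip: powr_numeral)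
  with False gap have "\<kappa> * d powr (q - 2) * d\<^sup>2 < 2 * \<beta> * d\<^sup>2"
    by (simp add: mult.assoc)
  then have "d powr (q - 2) \<le> 2 / \<kappa> * \<beta>"
    using d assms by (simp add: field_simps)
  then have "(d powr (q - 2)) powr (2 / (q - 2)) \<le> (2 / \<kappa> * \<beta>) powr (2 / (q - 2))"
    using assms by (intro powr_mono2) auto
  moreover have "(d powr (q - 2)) powr (2 / (q - 2)) = d\<^sup>2"
  proof -
    have "(q - 2) * (2 / (q - 2)) = 2" using assms by (simp add: field_simps)
    then show ?thesis using d by (simp only: powr_powr) simp
  qed
  moreover have "(2 / \<kappa> * \<beta>) powr (2 / (q - 2)) = (2 / \<kappa>) powr (2 / (q - 2)) * \<beta> powr (2 / (q - 2))"
    by (rule powr_mult)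
  ultimately have "d\<^sup>2 \<le> (2 / \<kappa>) powr (2 / (q - 2)) * \<beta> powr (2 / (q - 2))" by simp
  then have "\<beta> * d\<^sup>2 \<le> \<beta> * ((2 / \<kappa>) powr (2 / (q - 2)) * \<beta> powr (2 / (q - 2)))"
    using \<beta> by (intro mult_left_mono) auto
  also have "\<dots> = (2 / \<kappa>) powr (2 / (q - 2)) * \<beta> powr (1 + 2 / (q - 2))"
    using \<beta> by (simp add: powr_add)
  also have "1 + 2 / (q - 2) = q / (q - 2)" using assms by (simp add: field_simps)
  finally show ?thesis using G by simp
qed

subsection \<open>The linear oracle and the KKT conditions\<close>

text \<open>Minimality of \<open>v\<close> is tested at the midpoint of \<open>x\<close> and
  \<open>v\<close>, pushed in the direction \<open>- u\<close> by the distance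
  \<open>\<nu> / 4 * norm (x - v) powr q\<close> that uniform convexity permits.\<close>

lemma uniformly_convex_gap:
  assumes C: "uniformly_convex_set C \<nu> q" and xv: "x \<in> C" "v \<in> C"
    and v: "\<And>w. w \<in> C \<Longrightarrow> inner u v \<le> inner u w"
  shows "\<nu> / 2 * norm u * norm (x - v) powr q \<le> inner u (x - v)"
proof (cases "u = 0")
  case False
  let ?w = "- (u /\<^sub>R norm u)"
  let ?y = "(1/2) *\<^sub>R x + (1 - 1/2) *\<^sub>R v + ((1/2) * (1 - 1/2) * \<nu> * norm (x - v) powr q) *\<^sub>R ?w"
  have "norm ?w = 1" using False by simp
  then have "?y \<in> C"
    using C xv unfolding uniformly_convex_set_def by (elim conjE ballE[where x = "1/2"] ballE allE[where x = ?w]) auto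
  from v[OF this] have "inner u v \<le> (inner u x + inner u v) / 2 + \<nu> * norm (x - v) powr q / 4 * inner u ?w"
    by (simp add: inner_add_right inner_diff_right algebra_simps)
  moreover have "inner u ?w = - norm u"
    using False by (simp add: dot_square_norm power2_eq_square)
  ultimately have "inner u v \<le> (inner u x + inner u v) / 2 - \<nu> * norm (x - v) powr q / 4 * norm u"
    by simp
  then show ?thesis by (simp add: inner_diff_right algebra_simps)
qed simp

lemma is_minimizer_linear_oracle_Ind:
  assumes "is_minimizer (linear_oracle_obj (Ind C) u) v" "C \<noteq> {}"
  shows "v \<in> C" and "w \<in> C \<Longrightarrow> inner u v \<le> inner u w"
proof -
  have *: "\<not> ereal (inner u w) + Ind C w < ereal (inner u v) + Ind C v" for w
    using assms(1) by (auto simp: is_minimizer_def is_arg_min_def linear_oracle_obj_def)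
  show v: "v \<in> C"
  proof (rule ccontr)
    assume "v \<notin> C"
    moreover obtain w where "w \<in> C" using assms(2) by auto
    ultimately show False using *[of w] by (simp add: Ind_def)
  qed
  show "inner u v \<le> inner u w" if "w \<in> C"
    using *[of w] v that by (simp add: Ind_def)
qed

text \<open>A subgradient of the indicator is a normal vector, so its product with
  \<open>y - xs\<close> is nonpositive. Pairing stationarity with \<open>y - xs\<close>, applying
  the tangent inequalities and using complementarity gives the saddle inequality.\<close>

lemma KKT_saddle:
  fixes f :: "real ^ 'n \<Rightarrow> real" and g :: "real ^ 'n \<Rightarrow> real ^ 'm"
  assumes tangent: "\<And>y. f xs + inner (grad f xs) (y - xs) \<le> f y"
      "\<And>i y. g xs $ i + inner (grad (\<lambda>y. g y $ i) xs) (y - xs) \<le> g y $ i"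
    and kkt: "is_KKT_point f (Ind C) g xs zs" and C: "C \<noteq> {}"
  shows "xs \<in> C" "g xs \<le> 0" "0 \<le> zs" "y \<in> C \<Longrightarrow> f xs \<le> f y + inner zs (g y)"
proof -
  obtain s where s: "s \<in> subdifferential (Ind C) xs"
      "0 = grad f xs + s + (\<Sum>i\<in>UNIV. (zs $ i) *\<^sub>R grad (\<lambda>y. g y $ i) xs)"
    and kkt': "g xs \<le> 0" "0 \<le> zs" "inner zs (g xs) = 0"
    using kkt by (auto simp: is_KKT_point_def)
  have s': "Ind C xs + ereal (inner s (y - xs)) \<le> Ind C y" for y
    using s(1) by (simp add: subdifferential_def)
  show xs: "xs \<in> C"
  proof (rule ccontr)
    assume "xs \<notin> C"
    moreover obtain w where "w \<in> C" using C by auto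
    ultimately show False using s'[of w] by (simp add: Ind_def)
  qed
  show "g xs \<le> 0" "0 \<le> zs" by fact+
  assume y: "y \<in> C"
  have "inner s (y - xs) \<le> 0" using s'[of y] xs y by (simp add: Ind_def)
  moreover have "0 = inner (grad f xs) (y - xs) + inner s (y - xs)
      + (\<Sum>i\<in>UNIV. zs $ i * inner (grad (\<lambda>y. g y $ i) xs) (y - xs))"
    using arg_cong[OF s(2), of "\<lambda>w. inner w (y - xs)"] by (simp add: inner_add_left inner_sum_left)
  moreover have "(\<Sum>i\<in>UNIV. zs $ i * inner (grad (\<lambda>y. g y $ i) xs) (y - xs))
      \<le> (\<Sum>i\<in>UNIV. zs $ i * (g y $ i - g xs $ i))"
    using tangent(2)[of _ y] kkt'(2) by (intro sum_mono mult_left_mono) (auto simp: less_eq_vec_def algebra_simps)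
  moreover have "(\<Sum>i\<in>UNIV. zs $ i * (g y $ i - g xs $ i)) = inner zs (g y) - inner zs (g xs)"
    by (simp add: inner_vec_def right_diff_distrib sum_subtractf)
  ultimately show "f xs \<le> f y + inner zs (g y)"
    using tangent(1)[of y] kkt'(3) by linarith
qed

lemma inner_nonpos_of_nonneg:
  fixes w a :: "real ^ 'm"
  assumes "0 \<le> w" "a \<le> 0"
  shows "inner w a \<le> 0"
  unfolding inner_vec_def using assms
  by (intro sum_nonpos) (auto simp: less_eq_vec_def mult_nonneg_nonpos)

lemma optimal_value_Ind:
  fixes f :: "real ^ 'n \<Rightarrow> real" and g :: "real ^ 'n \<Rightarrow> real ^ 'm"
  assumes "xs \<in> C" "g xs \<le> 0" "0 \<le> zs" "\<And>y. y \<in> C \<Longrightarrow> f xs \<le> f y + inner zs (g y)"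
  shows "optimal_value f (Ind C) g = ereal (f xs)"
proof -
  have "f xs \<le> f y" if "y \<in> C" "g y \<le> 0" for y
    using assms(4)[OF that(1)] inner_nonpos_of_nonneg[OF assms(3) that(2)] by linarith
  then have "(INF x\<in>{x. g x \<le> 0}. ereal (f x) + Ind C x) = ereal (f xs)"
    using assms(1,2)
    by (intro antisym INF_greatest INF_lower2[of xs]) (auto simp: Ind_def)
  then show ?thesis by (simp add: optimal_value_def)
qed

text \<open>A dual step removes at most the fraction \<open>sig k / lam k \<le> 1\<close> of each
  component, which preserves nonnegativity. It adds at most \<open>sig k * B\<close>, and these
  increments are summable.\<close>

lemma multiplier_bounded:
  fixes zz :: "nat \<Rightarrow> real ^ 'm"
  assumes z0: "0 \<le> zz 0" and l: "\<And>k. 0 < lam k" and s: "\<And>k. 0 < sig k" "\<And>k. sig k \<le> lam k"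
    "summable sig"
    and step: "\<And>k. zz (Suc k) = zz k + sig k *\<^sub>R (\<chi> i. max (- (zz k $ i / lam k)) (w k $ i))"
    and w: "\<And>k i. w k $ i \<le> B" and B: "0 \<le> B"
  shows "0 \<le> zz k" and "norm (zz k) \<le> (\<Sum>i\<in>UNIV. zz 0 $ i + B * suminf sig)"
proof -
  have nn: "0 \<le> zz k $ i" for k i
  proof (induction k)
    case 0 then show ?case using z0 by (simp add: less_eq_vec_def)
  next
    case (Suc k)
    have "zz k $ i * (1 - sig k / lam k) \<le> zz k $ i + sig k * max (- (zz k $ i / lam k)) (w k $ i)"
      using mult_left_mono[of "- (zz k $ i / lam k)" "max (- (zz k $ i / lam k)) (w k $ i)" "sig k"] s(1)[of k]
      by (simp add: algebra_simps)
    moreover have "0 \<le> zz k $ i * (1 - sig k / lam k)"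
      using Suc l[of k] s(2)[of k] by simp
    ultimately show ?case unfolding step by simp
  qed
  then show "0 \<le> zz k" by (simp add: less_eq_vec_def)
  have up: "zz k $ i \<le> zz 0 $ i + B * sum sig {..<k}" for k i
  proof (induction k)
    case (Suc k)
    have "max (- (zz k $ i / lam k)) (w k $ i) \<le> B"
      using nn[of k i] l[of k] w[of k i] B by (simp add: order_trans[of _ 0])
    then have "zz (Suc k) $ i \<le> zz k $ i + sig k * B"
      unfolding step using s(1)[of k] by (simp add: mult_left_mono)
    with Suc show ?case by (simp add: algebra_simps)
  qed simp
  have "norm (zz k) \<le> (\<Sum>i\<in>UNIV. \<bar>zz k $ i\<bar>)" by (rule norm_le_l1_cart)
  also have "\<dots> \<le> (\<Sum>i\<in>UNIV. zz 0 $ i + B * suminf sig)"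
  proof (rule sum_mono)
    fix i
    have "sum sig {..<k} \<le> suminf sig" using s by (intro sum_le_suminf) (auto simp: less_imp_le)
    then have "B * sum sig {..<k} \<le> B * suminf sig" using B by (rule mult_left_mono)
    then show "\<bar>zz k $ i\<bar> \<le> zz 0 $ i + B * suminf sig" using up[of k i] nn[of k i] by linarith
  qed
  finally show "norm (zz k) \<le> (\<Sum>i\<in>UNIV. zz 0 $ i + B * suminf sig)" .
qed

subsection \<open>The rate of convergence\<close>

theorem mainTheorem4:
  fixes f :: "real ^ 'n \<Rightarrow> real"
    and h :: "real ^ 'n \<Rightarrow> ereal"
    and g :: "real ^ 'n \<Rightarrow> real ^ 'm"
    and Lf D \<nu> q \<epsilon> \<tau> p \<gamma> \<mu> \<omega> :: real
    and Lg :: "'m \<Rightarrow> real"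
    and C :: "(real ^ 'n) set"
    and xs :: "real ^ 'n" and zs :: "real ^ 'm"
    and lam sig alp :: "nat \<Rightarrow> real"
    and v x :: "nat \<Rightarrow> real ^ 'n" and z :: "nat \<Rightarrow> real ^ 'm"
  assumes f_convex: "convex_on UNIV f"
    and f_diff: "\<And>y. f differentiable at y"
    and f_lipschitz: "0 < Lf" "Lf-lipschitz_on UNIV (grad f)"
    and h_pcc: "proper_closed_convex h"
    and h_bounded: "0 < D" "\<And>y y'. y \<in> eff_dom h \<Longrightarrow> y' \<in> eff_dom h \<Longrightarrow> norm (y - y') \<le> D"
    and h_oracle: "\<And>u. \<exists>w. is_minimizer (linear_oracle_obj h u) w"
    and g_convex: "\<And>i. convex_on UNIV (\<lambda>y. g y $ i)"
    and g_diff: "\<And>i y. (\<lambda>y. g y $ i) differentiable at y"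
    and g_lipschitz: "\<And>i. 0 < Lg i" "\<And>i. (Lg i)-lipschitz_on (eff_dom h) (grad (\<lambda>y. g y $ i))"
    and kkt: "is_KKT_point f h g xs zs"
    and h_Ind: "h = Ind C"
    and C_compact: "compact C"
    and C_unif: "2 \<le> q" "0 < \<nu>" "uniformly_convex_set C \<nu> q"
    and grad_bound: "0 < \<epsilon>"
      "0 < (INF (y, w)\<in>{(y, w). (y, w) \<in> A_set g \<epsilon> \<and> y \<in> C}.
              norm (grad f y + (\<Sum>i\<in>UNIV. (w $ i) *\<^sub>R grad (\<lambda>u. g u $ i) y)))"
    and run: "algorithm_run f h g lam sig alp v x z"
    and tau: "0 < \<tau>" "\<tau> < 1"
    and lam_rate: "lam \<in> \<Theta>(\<lambda>k. real k powr \<tau>)"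
    and lam_step: "(\<lambda>k. lam (Suc k) - lam k) \<in> O(\<lambda>k. 1 / real k powr (1 - \<tau>))"
    and p: "\<tau> < p" "p < 1"
    and alp: "\<And>k. 0 < alp k" "\<And>k. alp k \<le> 1" "decseq alp" "alp \<in> \<Theta>(\<lambda>k. 1 / real k powr p)"
    and gamma: "0 < \<gamma>"
    and sig: "\<And>k. 0 < sig k" "\<And>k. sig k \<le> lam k" "sig \<in> \<Theta>(\<lambda>k. 1 / real k powr (1 + \<gamma>))"
    and mu: "\<mu> = 1 - 2 / q"
    and omega: "\<omega> = min (p - \<tau>) (1 - p + \<tau>)"
  shows "\<exists>e :: nat \<Rightarrow> real.
      (\<forall>k. ereal (e k) = max \<bar>ereal (f (x k)) + h (x k) - optimal_value f h g\<bar>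
                            (ereal (norm (pos_part (g (x k)))))) \<and>
      (\<mu> = 0 \<longrightarrow> e \<in> O(\<lambda>k. 1 / real k powr \<tau>)) \<and>
      (0 < \<mu> \<and> \<mu> < 1 \<longrightarrow>
         e \<in> O(\<lambda>k. max (1 / real k powr ((1 - \<mu>) * \<omega> + (p - \<tau>))) (1 / real k powr \<tau>))) \<and>
      (q = 2 \<longrightarrow> (\<forall>\<delta>>0. 1 - \<delta> \<le> \<tau> \<longrightarrow> e \<in> O(\<lambda>k. 1 / real k powr (1 - \<delta>))))"
proof -

  \<comment> \<open>Iterates and oracle directions in the feasible set\<close>
  have dom: "eff_dom h = C" by (auto simp: eff_dom_def h_Ind Ind_def)
  have C_ne: "C \<noteq> {}" using h_pcc dom by (auto simp: proper_closed_convex_def)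
  have C_convex: "convex C" using C_unif(3) by (simp add: uniformly_convex_set_def)
  have D_bound: "norm (y - y') \<le> D" if "y \<in> C" "y' \<in> C" for y y'
    using h_bounded(2) that by (simp add: dom)

  have x0: "x 0 \<in> C" and z0: "0 \<le> z 0"
    and lam_pos: "0 < lam k" and lam_mono: "strict_mono lam" and sig_sum: "summable sig"
    and minim: "is_minimizer (linear_oracle_obj (Ind C) (grad (\<lambda>y. F_aug f g (lam k) y (z k)) (x k))) (v k)"
    and x_step: "x (Suc k) = x k + alp k *\<^sub>R (v k - x k)"
    and z_step: "z (Suc k) = z k + sig k *\<^sub>R (\<chi> i. max (- (z k $ i / lam k)) (g (x (Suc k)) $ i))" for k
    using run unfolding algorithm_run_def dom by (simp_all add: h_Ind)
  have lam_le: "lam k \<le> lam (Suc k)" and lam0: "lam 0 \<le> lam k" for k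
    using strict_mono_less_eq[OF lam_mono] by auto

  \<comment> \<open>The pair later shown to lie in \<open>A_set\<close> is \<open>(x k, w k)\<close>
    rather than \<open>(x k, z k)\<close>, since the oracle direction \<open>u k\<close> is the
    Lagrangian gradient at \<open>w k\<close>.\<close>
  define w where "w k = multiplier_estimate g (lam k) (x k) (z k)" for k
  define u where "u k = lagrangian_grad f g (x k) (w k)" for k
  have u_eq: "grad (\<lambda>y. F_aug f g (lam k) y (z k)) (x k) = u k" for k
    unfolding u_def w_def using f_diff g_diff lam_pos by (rule grad_F_aug)
  have vC: "v k \<in> C" and vmin: "y \<in> C \<Longrightarrow> inner (u k) (v k) \<le> inner (u k) y" for k y
    using is_minimizer_linear_oracle_Ind[OF minim C_ne] by (auto simp: u_eq)
  have xC: "x k \<in> C" for k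
  proof (induction k)
    case (Suc k)
    have "x (Suc k) = (1 - alp k) *\<^sub>R x k + alp k *\<^sub>R v k"
      unfolding x_step by (simp add: algebra_simps)
    then show ?case
      using convexD_alt[OF C_convex Suc vC[of k]] alp(1,2)[of k] by (simp add: less_imp_le)
  qed (rule x0)

  \<comment> \<open>Uniform bounds on constraints, gradients and multipliers\<close>
  have "continuous_on C (\<lambda>y. \<chi> i. g y $ i)"
    using differentiable_imp_continuous_within[OF g_diff]
    by (intro continuous_on_vec_lambda continuous_at_imp_continuous_on ballI)
  then have "continuous_on C g" by simp
  then have "bounded (g ` C)"
    by (intro compact_imp_bounded compact_continuous_image C_compact)
  then obtain B where B: "0 < B" "\<And>y. y \<in> C \<Longrightarrow> norm (g y) \<le> B"
    by (auto simp: bounded_pos)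
  then have gB: "g y $ i \<le> B" if "y \<in> C" for y i
    using component_le_norm_cart[of "g y" i] B(2)[OF that] by linarith
  have "bounded (grad (\<lambda>y. g y $ i) ` C)" for i
    using g_lipschitz(2)[of i] by (intro compact_imp_bounded compact_continuous_image C_compact
        lipschitz_on_continuous_on) (simp add: dom)
  then have "bounded (\<Union>i. grad (\<lambda>y. g y $ i) ` C)" by (intro bounded_UN) auto
  then obtain M where M: "norm (grad (\<lambda>y. g y $ i) y) \<le> M" if "y \<in> C" for y i
    by (auto simp: bounded_pos)

  have z_nonneg: "0 \<le> z k" for k
    by (rule multiplier_bounded(1)[OF z0 lam_pos sig(1,2) sig_sum z_step]) (use gB xC B in auto)
  define Z where "Z = (\<Sum>i\<in>UNIV. z 0 $ i + B * suminf sig)"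
  have Z: "norm (z k) \<le> Z" for k unfolding Z_def
    by (rule multiplier_bounded(2)[OF z0 lam_pos sig(1,2) sig_sum z_step]) (use gB xC B in auto)
  have Z0: "0 \<le> Z" by (rule order_trans[OF norm_ge_zero Z])

  \<comment> \<open>Saddle inequality and lower bounds for the augmented Lagrangian\<close>
  have xsC: "xs \<in> C" and gxs: "g xs \<le> 0" and zs: "0 \<le> zs"
    and saddle: "y \<in> C \<Longrightarrow> f xs \<le> f y + inner zs (g y)" for y
    using KKT_saddle[OF convex_on_gradient_ineq[OF f_convex GDERIV_grad[OF f_diff]]
        convex_on_gradient_ineq[OF g_convex GDERIV_grad[OF g_diff]] kkt[unfolded h_Ind] C_ne] by auto
  have opt: "optimal_value f h g = ereal (f xs)"
    unfolding h_Ind using xsC gxs zs saddle by (rule optimal_value_Ind)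

  define F where "F k y = F_aug f g (lam k) y (z k)" for k y
  define viol where "viol y = norm (pos_part (g y))" for y
  \<comment> \<open>The first term comes from completing the square in
    \<open>norm zs * viol y\<close> against half of the quadratic penalty, the second from the
    multiplier term lost in \<open>F_aug_lower\<close>.\<close>
  define E where "E = (norm zs)\<^sup>2 + Z\<^sup>2 / 2"
  have E0: "0 \<le> E" by (simp add: E_def)
  have viol0: "0 \<le> viol y" for y by (simp add: viol_def)
  have saddle': "f xs - norm zs * viol y \<le> f y" if "y \<in> C" for y
    using saddle[OF that] inner_le_norm_pos_part[OF zs, of "g y"] by (simp add: viol_def)
  have zsq: "(norm (z k))\<^sup>2 \<le> Z\<^sup>2" for k using Z by (intro power_mono) auto
  have zl: "(norm (z k))\<^sup>2 / (2 * lam k) \<le> Z\<^sup>2 / 2 / lam k" for k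
    using zsq[of k] lam_pos[of k] by (simp add: field_simps)
  have F_f: "f y \<le> F k y + E / lam k" for k y
  proof -
    have "f y + lam k / 2 * (viol y)\<^sup>2 - (norm (z k))\<^sup>2 / (2 * lam k) \<le> F k y"
      unfolding F_def viol_def using lam_pos z_nonneg by (rule F_aug_lower)
    moreover have "0 \<le> lam k / 2 * (viol y)\<^sup>2" "0 \<le> (norm zs)\<^sup>2 / lam k"
      using lam_pos[of k] by simp_all
    moreover have "E / lam k = (norm zs)\<^sup>2 / lam k + Z\<^sup>2 / 2 / lam k" by (simp add: E_def add_divide_distrib)
    ultimately show ?thesis using zl[of k] by linarith
  qed
  have F_viol: "lam k / 4 * (viol y)\<^sup>2 \<le> F k y - f xs + E / lam k" if "y \<in> C" for k y
  proof -
    have "f y + lam k / 2 * (viol y)\<^sup>2 - (norm (z k))\<^sup>2 / (2 * lam k) \<le> F k y"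
      unfolding F_def viol_def using lam_pos z_nonneg by (rule F_aug_lower)
    moreover have "norm zs * viol y \<le> lam k / 4 * (viol y)\<^sup>2 + (norm zs)\<^sup>2 / lam k"
    proof -
      have "0 \<le> (lam k * viol y / 2 - norm zs)\<^sup>2 / lam k" using lam_pos[of k] by simp
      also have "\<dots> = lam k / 4 * (viol y)\<^sup>2 + (norm zs)\<^sup>2 / lam k - norm zs * viol y"
        using lam_pos[of k] by (simp add: power2_eq_square field_simps)
      finally show ?thesis by simp
    qed
    moreover have "E / lam k = (norm zs)\<^sup>2 / lam k + Z\<^sup>2 / 2 / lam k" by (simp add: E_def add_divide_distrib)
    moreover have "lam k / 2 * (viol y)\<^sup>2 = lam k / 4 * (viol y)\<^sup>2 + lam k / 4 * (viol y)\<^sup>2" by simp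
    ultimately show ?thesis using saddle'[OF that] zl[of k] by linarith
  qed

  \<comment> \<open>One-step estimates for the energy\<close>
  define En where "En k = F k (x k) - f xs + E / lam k" for k
  \<comment> \<open>The primal step is separated from the parameter update: the point has moved, but
    penalty and multipliers are still those of step \<open>k\<close>.\<close>
  define P where "P k = F k (x (Suc k)) - f xs + E / lam k" for k
  define d where "d k = sig k + (lam (Suc k) - lam k) / 2" for k
  define G where "G k = inner (u k) (x k - v k)" for k
  define X where "X k = norm (x k - v k)" for k
  have d0: "0 \<le> d k" for k using sig(1)[of k] lam_le[of k] by (simp add: d_def)
  have En0: "0 \<le> En k" for k
    unfolding En_def using lam_pos[of k] by (intro order_trans[OF _ F_viol[OF xC]]) simp
  have En_step: "En (Suc k) \<le> P k + d k * ((viol (x (Suc k)))\<^sup>2 + Z\<^sup>2 / (lam k)\<^sup>2)" for k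
  proof -
    have "F (Suc k) (x (Suc k)) \<le> F k (x (Suc k)) + d k * ((viol (x (Suc k)))\<^sup>2 + (norm (z k))\<^sup>2 / (lam k)\<^sup>2)"
      unfolding F_def viol_def d_def z_step
      using lam_pos lam_le sig(1) z_nonneg by (intro F_aug_parameter_change) (auto simp: less_imp_le)
    also have "\<dots> \<le> F k (x (Suc k)) + d k * ((viol (x (Suc k)))\<^sup>2 + Z\<^sup>2 / (lam k)\<^sup>2)"
      using zsq d0 by (intro add_mono mult_left_mono divide_right_mono) auto
    moreover have "E / lam (Suc k) \<le> E / lam k"
      using lam_le lam_pos E0 by (intro divide_left_mono) auto
    ultimately show ?thesis by (simp add: En_def P_def)
  qed
  \<comment> \<open>Convexity is used at the KKT point, where feasibility gives
    \<open>F k xs \<le> f xs\<close>, and the oracle does at least as well as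
    \<open>xs\<close>.\<close>
  have G_gap: "F k (x k) - f xs \<le> G k" for k
  proof -
    have "F k (x k) + inner (u k) (xs - x k) \<le> F k xs"
      unfolding F_def u_def w_def by (rule F_aug_convex_lower[OF f_convex f_diff g_convex g_diff lam_pos])
    also have "F k xs \<le> f xs" unfolding F_def using lam_pos z_nonneg gxs by (rule F_aug_feasible_le)
    finally show ?thesis using vmin[OF xsC, of k] by (simp add: G_def inner_diff_right)
  qed
  have G0: "0 \<le> G k" for k using vmin[OF xC, of k k] by (simp add: G_def inner_diff_right)

  \<comment> \<open>Because \<open>lam 0 \<le> lam k\<close>, dividing the curvature constant of
    \<open>F_aug_descent\<close> by \<open>lam k\<close> leaves a bound independent of
    \<open>k\<close>.\<close>
  define K where "K = Lf / lam 0 + (\<Sum>i\<in>UNIV. (B + Z / lam 0) * Lg i + M\<^sup>2 / 2)"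
  \<comment> \<open>This is the smoothness error per unit of \<open>alp k * (X k)\<^sup>2\<close>;
    it decays like \<open>real k powr -(p - \<tau>)\<close>.\<close>
  define \<beta> where "\<beta> k = K * lam k * alp k" for k
  have K0: "0 \<le> K"
    unfolding K_def using f_lipschitz(1) lam_pos[of 0] B(1) Z0 g_lipschitz(1)
    by (auto intro!: add_nonneg_nonneg sum_nonneg mult_nonneg_nonneg divide_nonneg_pos simp: less_imp_le)
  have \<beta>0: "0 \<le> \<beta> k" for k
    unfolding \<beta>_def using K0 lam_pos[of k] alp(1)[of k] by (simp add: less_imp_le)
  have P_step: "P k \<le> En k - alp k * G k + alp k * (\<beta> k * (X k)\<^sup>2)" for k
  proof -
    have "w k $ i * Lg i + lam k / 2 * M\<^sup>2 \<le> lam k * ((B + Z / lam 0) * Lg i + M\<^sup>2 / 2)" for i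
    proof -
      have "z k $ i \<le> Z" using component_le_norm_cart[of "z k" i] Z[of k] by linarith
      then have "z k $ i / lam k \<le> Z / lam 0"
        using lam_pos lam0 Z0 by (intro frac_le) auto
      moreover have "0 \<le> Z / lam 0" using Z0 lam_pos[of 0] by simp
      ultimately have "max (g (x k) $ i + z k $ i / lam k) 0 \<le> B + Z / lam 0"
        using gB[OF xC, of k i] B(1) by linarith
      then have "w k $ i \<le> lam k * (B + Z / lam 0)"
        using lam_pos[of k] by (simp add: w_def multiplier_estimate_def)
      then have "w k $ i * Lg i \<le> lam k * (B + Z / lam 0) * Lg i"
        using g_lipschitz(1)[of i] by (intro mult_right_mono) auto
      then show ?thesis by (simp add: algebra_simps)
    qed
    then have "(\<Sum>i\<in>UNIV. w k $ i * Lg i + lam k / 2 * M\<^sup>2)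
        \<le> lam k * (\<Sum>i\<in>UNIV. (B + Z / lam 0) * Lg i + M\<^sup>2 / 2)"
      unfolding sum_distrib_left by (rule sum_mono)
    moreover have "Lf \<le> lam k * (Lf / lam 0)"
      using lam0[of k] lam_pos[of 0] f_lipschitz(1) by (simp add: field_simps)
    ultimately have K: "Lf + (\<Sum>i\<in>UNIV. w k $ i * Lg i + lam k / 2 * M\<^sup>2) \<le> lam k * K"
      by (simp add: K_def distrib_left)
    have "F k (x (Suc k)) \<le> F k (x k) + inner (u k) (x (Suc k) - x k)
        + (Lf + (\<Sum>i\<in>UNIV. w k $ i * Lg i + lam k / 2 * M\<^sup>2)) * (norm (x (Suc k) - x k))\<^sup>2"
      unfolding F_def u_def w_def
      by (rule F_aug_descent[where S = C, OF f_diff lipschitz_on_subset[OF f_lipschitz(2)] g_diff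
            g_lipschitz(2)[unfolded dom] M lam_pos C_convex xC xC]) auto
    also have "\<dots> \<le> F k (x k) + inner (u k) (x (Suc k) - x k) + lam k * K * (norm (x (Suc k) - x k))\<^sup>2"
      using K by (intro add_left_mono mult_right_mono) auto
    also have "inner (u k) (x (Suc k) - x k) = - alp k * G k"
      by (simp add: x_step G_def inner_diff_right algebra_simps)
    also have "(norm (x (Suc k) - x k))\<^sup>2 = (alp k)\<^sup>2 * (X k)\<^sup>2"
      by (simp add: x_step X_def power_mult_distrib norm_minus_commute)
    finally show ?thesis
      by (simp add: P_def En_def \<beta>_def power2_eq_square algebra_simps)
  qed

  \<comment> \<open>Explicit constants for the parameter rates\<close>
  obtain cl where cl: "0 < cl" "\<forall>\<^sub>F k in sequentially. cl * real k powr \<tau> \<le> lam k"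
    by (rule bigomegaE_nonneg[OF bigthetaD2[OF lam_rate]]) (auto simp: less_imp_le[OF lam_pos])
  obtain Cl where Cl: "0 < Cl" "\<forall>\<^sub>F k in sequentially. lam k \<le> Cl * real k powr \<tau>"
    by (rule bigoE_nonneg[OF bigthetaD1[OF lam_rate]]) (auto simp: less_imp_le[OF lam_pos])
  have alp_rate: "alp \<in> \<Theta>(\<lambda>k. real k powr -p)"
    using alp(4) by (simp add: powr_minus divide_inverse)
  obtain ca where ca: "0 < ca" "\<forall>\<^sub>F k in sequentially. ca * real k powr -p \<le> alp k"
    by (rule bigomegaE_nonneg[OF bigthetaD2[OF alp_rate]]) (auto simp: less_imp_le[OF alp(1)])
  obtain Ca where Ca: "0 < Ca" "\<forall>\<^sub>F k in sequentially. alp k \<le> Ca * real k powr -p"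
    by (rule bigoE_nonneg[OF bigthetaD1[OF alp_rate]]) (auto simp: less_imp_le[OF alp(1)])
  obtain cd where cd: "0 < cd" "\<forall>\<^sub>F k in sequentially. d k \<le> cd * real k powr -(1 - \<tau>)"
  proof -
    have "(\<lambda>k. 1 / real k powr (1 + \<gamma>)) \<in> O(\<lambda>k. 1 / real k powr (1 - \<tau>))"
      using tau gamma by (intro bigoI[of _ 1] eventually_mono[OF eventually_ge_at_top[of 1]])
        (auto intro!: divide_left_mono powr_mono)
    then have "sig \<in> O(\<lambda>k. 1 / real k powr (1 - \<tau>))"
      using bigthetaD1[OF sig(3)] landau_o.big_trans by blast
    then have "d \<in> O(\<lambda>k. 1 / real k powr (1 - \<tau>))"
      unfolding d_def using lam_step by (intro sum_in_bigo) simp_all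
    then have "d \<in> O(\<lambda>k. real k powr -(1 - \<tau>))" by (simp only: powr_minus divide_inverse mult_1)
    then show thesis by (rule bigoE_nonneg) (auto simp: d0 intro: that)
  qed
  define s where "s = p - \<tau>"
  have s: "0 < s" using p by (simp add: s_def)
  define b where "b = K * Cl * Ca"
  have b0: "0 \<le> b" using K0 Cl Ca by (simp add: b_def)
  have \<beta>_rate: "\<forall>\<^sub>F k in sequentially. \<beta> k \<le> b * real k powr -s"
    using Cl(2) Ca(2)
  proof eventually_elim
    case (elim k)
    have "lam k * alp k \<le> (Cl * real k powr \<tau>) * (Ca * real k powr -p)"
      using elim lam_pos[of k] alp(1)[of k] Cl(1) by (intro mult_mono) (auto simp: less_imp_le)
    also have "\<dots> = Cl * Ca * real k powr -s" by (simp add: s_def powr_add[symmetric])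
    finally have "K * (lam k * alp k) \<le> K * (Cl * Ca * real k powr -s)" using K0 by (rule mult_left_mono)
    then show ?case by (simp add: \<beta>_def b_def mult.assoc)
  qed
  have powr_le: "real k powr -t \<le> real k powr -t'" if "t' \<le> t" "1 \<le> k" for t t' k
    using that by (intro powr_mono) auto

  have lam_inv: "\<forall>\<^sub>F k in sequentially. 1 / lam k \<le> 1 / cl * real k powr -\<tau>"
    using cl(2) eventually_ge_at_top[of 1]
  proof eventually_elim
    case (elim k)
    then have "1 / lam k \<le> 1 / (cl * real k powr \<tau>)"
      using cl(1) lam_pos[of k] by (intro divide_left_mono) auto
    then show ?case by (simp add: powr_minus divide_inverse)
  qed

  text \<open>A rate for the smoothness error relative to the Frank--Wolfe gap turns into the same rate for
    the energy, up to \<open>k\<^sup>-\<^sup>\<tau>\<close>. This is used once with the diameter bound, to reach the region where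
    hypothesis (b) applies, and a second time with the uniform convexity of \<^term>\<open>C\<close>.\<close>
  have energy: "\<exists>M\<ge>0. \<forall>\<^sub>F k in sequentially. En k \<le> M * real k powr -r"
    if r: "0 \<le> r" "r \<le> \<tau>" and b': "0 \<le> b'"
      and gap: "\<forall>\<^sub>F k in sequentially. \<beta> k * (X k)\<^sup>2 \<le> G k / 2 + b' * real k powr -r" for r b'
  proof (rule penalty_energy_rate[where lam = lam and alp = alp and d = d and P = P and E = "Z\<^sup>2" and p = p
        and \<tau> = \<tau> and a = ca and A = Ca and c = cl and c' = cd and b = "b' + E / cl"
        and N = "\<lambda>k. (viol (x (Suc k)))\<^sup>2" and e = "\<lambda>k. b' * real k powr -r + E / lam k"])
    show "lam k / 4 * (viol (x (Suc k)))\<^sup>2 \<le> P k" for k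
      using F_viol[OF xC, of k "Suc k"] by (simp add: P_def)
    show "\<forall>\<^sub>F k in sequentially. P k \<le> (1 - alp k / 2) * En k + alp k * (b' * real k powr -r + E / lam k)"
      using gap
    proof eventually_elim
      case (elim k)
      have "alp k * (\<beta> k * (X k)\<^sup>2) \<le> alp k * (G k / 2 + b' * real k powr -r)"
        using elim alp(1)[of k] by (intro mult_left_mono) auto
      moreover have "alp k / 2 * En k \<le> alp k / 2 * (G k + E / lam k)"
        using G_gap[of k] alp(1)[of k] by (intro mult_left_mono) (auto simp: En_def)
      moreover have "0 \<le> alp k * (E / lam k)" using alp(1)[of k] E0 lam_pos[of k] by simp
      ultimately show ?case using P_step[of k] by (simp add: algebra_simps)
    qed
    show "\<forall>\<^sub>F k in sequentially. b' * real k powr -r + E / lam k \<le> (b' + E / cl) * real k powr -r"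
      using lam_inv eventually_ge_at_top[of 1]
    proof eventually_elim
      case (elim k)
      have "E * (1 / lam k) \<le> E * (1 / cl * real k powr -\<tau>)" using elim E0 by (intro mult_left_mono) auto
      also have "\<dots> \<le> E * (1 / cl * real k powr -r)"
        using powr_le[OF r(2) elim(2)] E0 cl(1) by (intro mult_left_mono) auto
      finally show ?case by (simp add: algebra_simps)
    qed
  qed (use p tau r b' ca Ca cl cd alp lam_pos d0 En0 En_step E0 in \<open>auto simp: less_imp_le\<close>)

  have viol_sq: "(viol (x k))\<^sup>2 \<le> 4 * (1 / lam k) * En k" for k
    using F_viol[OF xC, of k k] lam_pos[of k] by (simp add: En_def field_simps)

  have lim0: "((\<lambda>k. c * real k powr -t) \<longlongrightarrow> 0) sequentially" if "t > 0" for t c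
    using that by (intro tendsto_mult_right_zero tendsto_neg_powr filterlim_real_sequentially) auto

  \<comment> \<open>Vanishing constraint violation and the improved gap\<close>
  have viol_small: "\<forall>\<^sub>F k in sequentially. viol (x k) < \<epsilon>"
  proof -
    \<comment> \<open>The diameter bound turns the smoothness error into a multiple of
      \<open>real k powr -s\<close>, and \<open>energy\<close> admits exponents up to
      \<open>\<tau>\<close>. Any positive rate suffices to bring the violation below
      \<open>\<epsilon>\<close>.\<close>
    define r where "r = min s \<tau>"
    have r: "0 < r" "r \<le> s" "r \<le> \<tau>" using s tau by (auto simp: r_def)
    have "\<exists>M\<ge>0. \<forall>\<^sub>F k in sequentially. En k \<le> M * real k powr -r"
    proof (rule energy[where b' = "b * D\<^sup>2"])
      show "\<forall>\<^sub>F k in sequentially. \<beta> k * (X k)\<^sup>2 \<le> G k / 2 + b * D\<^sup>2 * real k powr -r"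
        using \<beta>_rate eventually_ge_at_top[of 1]
      proof eventually_elim
        case (elim k)
        have "(X k)\<^sup>2 \<le> D\<^sup>2" unfolding X_def using D_bound[OF xC vC] by (intro power_mono) auto
        then have "\<beta> k * (X k)\<^sup>2 \<le> (b * real k powr -s) * D\<^sup>2"
          using elim \<beta>0 b0 by (intro mult_mono) auto
        also have "\<dots> \<le> (b * real k powr -r) * D\<^sup>2"
          using powr_le[OF r(2) elim(2)] b0 by (intro mult_right_mono mult_left_mono) auto
        finally show ?case using G0[of k] by (simp add: algebra_simps)
      qed
    qed (use r b0 in auto)
    then obtain M' where M': "0 \<le> M'" "\<forall>\<^sub>F k in sequentially. En k \<le> M' * real k powr -r" by auto
    have "\<forall>\<^sub>F k in sequentially. (4 / lam 0 * M') * real k powr -r < \<epsilon>\<^sup>2"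
      by (rule order_tendstoD(2)[OF lim0[OF r(1)]]) (use grad_bound(1) in simp)
    then show ?thesis using M'(2)
    proof eventually_elim
      case (elim k)
      have "1 / lam k \<le> 1 / lam 0" using lam0[of k] lam_pos[of 0] by (intro frac_le) auto
      then have "4 * (1 / lam k) * En k \<le> 4 * (1 / lam 0) * (M' * real k powr -r)"
        using elim(2) En0[of k] lam_pos[of 0] lam_pos[of k] by (intro mult_mono) simp_all
      also have "\<dots> = (4 / lam 0 * M') * real k powr -r" by simp
      finally have "(viol (x k))\<^sup>2 < \<epsilon>\<^sup>2" using viol_sq[of k] elim(1) by linarith
      then show ?case by (rule power2_less_imp_less) (use grad_bound(1) in simp)
    qed
  qed

  define c where "c = (INF (y, w)\<in>{(y, w). (y, w) \<in> A_set g \<epsilon> \<and> y \<in> C}. norm (lagrangian_grad f g y w))"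
  have c: "0 < c" using grad_bound(2) by (simp add: c_def lagrangian_grad_def)
  have c_le: "c \<le> norm (lagrangian_grad f g y w)" if "(y, w) \<in> A_set g \<epsilon>" "y \<in> C" for y w
  proof -
    have "bdd_below ((\<lambda>(y, w). norm (lagrangian_grad f g y w)) ` {(y, w). (y, w) \<in> A_set g \<epsilon> \<and> y \<in> C})"
      by (rule bdd_belowI2[of _ 0]) (simp add: case_prod_beta)
    then show ?thesis
      unfolding c_def using that by (rule_tac cINF_lower2[where x = "(y, w)"]) simp_all
  qed
  define \<kappa> where "\<kappa> = \<nu> / 2 * c"
  have \<kappa>: "0 < \<kappa>" using C_unif(2) c by (simp add: \<kappa>_def)
  have gap: "\<forall>\<^sub>F k in sequentially. \<kappa> * X k powr q \<le> G k"
  proof -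
    \<comment> \<open>Once \<open>Z / lam k < \<epsilon>\<close>, a constraint value below
      \<open>- \<epsilon>\<close> stays negative after the shift by \<open>z k $ i / lam k\<close>,
      so its multiplier estimate vanishes as \<open>A_set\<close> demands.\<close>
    have "\<forall>\<^sub>F k in sequentially. (Z * (1 / cl)) * real k powr -\<tau> < \<epsilon>"
      by (rule order_tendstoD(2)[OF lim0[OF tau(1)]]) (use grad_bound(1) in simp)
    then show ?thesis using viol_small lam_inv
    proof eventually_elim
      case (elim k)
      have "Z * (1 / lam k) \<le> Z * (1 / cl * real k powr -\<tau>)" using elim Z0 by (intro mult_left_mono) auto
      with elim have Zl: "Z / lam k < \<epsilon>" by (simp add: mult.assoc)
      have "(x k, w k) \<in> A_set g \<epsilon>"
      proof -
        have "g (x k) $ i \<le> \<epsilon>" for i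
          using component_le_norm_cart[of "pos_part (g (x k))" i] elim(2)
          by (simp add: viol_def pos_part_def)
        moreover have "w k $ i = 0" if "g (x k) $ i < - \<epsilon>" for i
        proof -
          have "z k $ i \<le> Z" using component_le_norm_cart[of "z k" i] Z[of k] by linarith
          then have "z k $ i / lam k \<le> Z / lam k" using lam_pos[of k] by (intro divide_right_mono) auto
          then show ?thesis using that Zl by (simp add: w_def multiplier_estimate_def)
        qed
        moreover have "0 \<le> w k"
          using lam_pos[of k] by (simp add: w_def multiplier_estimate_def less_eq_vec_def)
        ultimately show ?thesis by (simp add: A_set_def)
      qed
      then have "c \<le> norm (u k)" unfolding u_def using xC by (rule c_le)
      then have "\<nu> / 2 * c * X k powr q \<le> \<nu> / 2 * norm (u k) * X k powr q"
        using C_unif(2) by (intro mult_right_mono mult_left_mono) auto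
      also have "\<dots> \<le> G k"
        unfolding X_def G_def using uniformly_convex_gap[OF C_unif(3) xC vC vmin] .
      finally show ?case by (simp add: \<kappa>_def)
    qed
  qed

  \<comment> \<open>From the energy to optimality and feasibility errors\<close>
  define e where "e k = max \<bar>f (x k) - f xs\<bar> (viol (x k))" for k
  have e_eq: "ereal (e k) = max \<bar>ereal (f (x k)) + h (x k) - optimal_value f h g\<bar>
      (ereal (norm (pos_part (g (x k)))))" for k
    using xC[of k] unfolding opt by (simp add: e_def h_Ind Ind_def viol_def)

  have e_rate: "e \<in> O(\<lambda>k. real k powr -r)"
    if r: "0 \<le> r" "r \<le> \<tau>" and b': "0 \<le> b'"
      and gap: "\<forall>\<^sub>F k in sequentially. \<beta> k * (X k)\<^sup>2 \<le> G k / 2 + b' * real k powr -r" for r b'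
  proof -
    obtain M' where M': "0 \<le> M'" "\<forall>\<^sub>F k in sequentially. En k \<le> M' * real k powr -r"
      using energy[OF r b' gap] by auto
    \<comment> \<open>The squared violation is at most \<open>4 / lam k * En k\<close>. As
      \<open>r \<le> \<tau>\<close>, both factors decay like \<open>real k powr -r\<close>, so the
      violation itself has this rate after the square root. The lower bound on the objective error
      then follows from the saddle inequality.\<close>
    define V where "V = sqrt (4 * (1 / cl) * M')"
    have V: "0 \<le> V" "V\<^sup>2 = 4 * (1 / cl) * M'" using cl(1) M'(1) by (auto simp: V_def)
    have "\<forall>\<^sub>F k in sequentially. norm (e k) \<le> (M' + V + norm zs * V) * norm (real k powr -r)"
      using M'(2) lam_inv eventually_ge_at_top[of 1]
    proof eventually_elim
      case (elim k)
      let ?R = "real k powr -r"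
      have "1 / lam k \<le> 1 / cl * ?R"
        using powr_le[OF r(2) elim(3)] cl(1)
        by (intro order_trans[OF elim(2)] mult_left_mono) auto
      then have "4 * (1 / lam k) * En k \<le> 4 * (1 / cl * ?R) * (M' * ?R)"
        using elim En0 lam_pos[of k] cl(1) by (intro mult_mono) (auto simp: less_imp_le)
      also have "\<dots> = (V * ?R)\<^sup>2" by (simp add: power_mult_distrib V(2)) (simp add: power2_eq_square)
      finally have "(viol (x k))\<^sup>2 \<le> (V * ?R)\<^sup>2" using viol_sq[of k] by linarith
      then have vb: "viol (x k) \<le> V * ?R" by (rule power2_le_imp_le) (use V(1) in simp)
      have "f (x k) - f xs \<le> M' * ?R"
        using F_f[of "x k" k] elim(1) by (simp add: En_def)
      moreover have "norm zs * viol (x k) \<le> norm zs * (V * ?R)" using vb by (intro mult_left_mono) auto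
      then have "f xs - f (x k) \<le> norm zs * (V * ?R)" using saddle'[OF xC, of k] by linarith
      moreover have "0 \<le> M' * ?R" "0 \<le> V * ?R" "0 \<le> norm zs * (V * ?R)" using M'(1) V(1) by auto
      ultimately have "e k \<le> M' * ?R + V * ?R + norm zs * (V * ?R)" using vb unfolding e_def by linarith
      moreover have "0 \<le> e k" using viol0[of "x k"] by (simp add: e_def)
      ultimately show ?case by (simp add: algebra_simps)
    qed
    then show ?thesis by (rule bigoI)
  qed

  have case_q2: "e \<in> O(\<lambda>k. 1 / real k powr \<tau>)" if q2: "q = 2"
  proof -
    \<comment> \<open>For \<open>q = 2\<close> the gap is itself quadratic in \<open>X k\<close>, so
      once \<open>\<beta> k\<close> is below \<open>\<kappa> / 2\<close> half of the gap absorbs the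
      whole error and \<open>b' = 0\<close> works.\<close>
    have "\<forall>\<^sub>F k in sequentially. b * real k powr -s < \<kappa> / 2"
      by (rule order_tendstoD(2)[OF lim0[OF s]]) (use \<kappa> in simp)
    then have "\<forall>\<^sub>F k in sequentially. \<beta> k * (X k)\<^sup>2 \<le> G k / 2 + 0 * real k powr -\<tau>"
      using gap \<beta>_rate
    proof eventually_elim
      case (elim k)
      have "\<beta> k * (X k)\<^sup>2 \<le> \<kappa> / 2 * (X k)\<^sup>2" using elim by (intro mult_right_mono) auto
      moreover have "X k powr q = (X k)\<^sup>2" by (simp add: q2 X_def)
      ultimately show ?case using elim by simp
    qed
    then have "e \<in> O(\<lambda>k. real k powr -\<tau>)" using tau by (intro e_rate[where b' = 0]) auto
    then show ?thesis by (simp only: powr_minus divide_inverse mult_1)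
  qed

  have case_mu: "e \<in> O(\<lambda>k. max (1 / real k powr ((1 - \<mu>) * \<omega> + (p - \<tau>))) (1 / real k powr \<tau>))"
    if mu1: "0 < \<mu>" "\<mu> < 1"
  proof -
    have q2: "2 < q" using mu1(1) C_unif(1) by (simp add: mu field_simps)
    have mu_q: "q / (q - 2) = 1 / \<mu>" using q2 by (simp add: mu field_simps)
    define r' where "r' = (1 - \<mu>) * \<omega> + s"
    define r where "r = min r' \<tau>"
    have \<omega>: "0 \<le> \<omega>" "\<omega> \<le> s" using p tau by (auto simp: omega s_def)
    have "0 \<le> r'" unfolding r'_def using mu1 \<omega> s by simp
    then have r: "0 \<le> r" "r \<le> \<tau>" "r \<le> r'" using tau by (auto simp: r_def)
    have "r' \<le> s * (1 / \<mu>)"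
    proof -
      have "r' \<le> (1 - \<mu>) * s + s" unfolding r'_def using \<omega> mu1 by (intro add_mono mult_left_mono) auto
      also have "\<dots> = (\<mu> * (2 - \<mu>)) * s * (1 / \<mu>)" using mu1 by (simp add: field_simps)
      also have "\<dots> \<le> 1 * s * (1 / \<mu>)"
      proof (intro mult_right_mono)
        have "0 \<le> (1 - \<mu>)\<^sup>2" by simp
        then show "\<mu> * (2 - \<mu>) \<le> 1" by (simp add: power2_eq_square algebra_simps)
      qed (use s mu1 in auto)
      finally show ?thesis by simp
    qed
    with r have rs: "r \<le> s * (1 / \<mu>)" by linarith
    \<comment> \<open>With \<open>q / (q - 2) = 1 / \<mu>\<close>, the remainder in
      \<open>powr_absorb\<close> is a power of \<open>\<beta> k\<close> with decay exponent
      \<open>s / \<mu>\<close>, which is at least \<open>r\<close>.\<close>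
    define b' where "b' = (2 / \<kappa>) powr (2 / (q - 2)) * b powr (1 / \<mu>)"
    have "\<forall>\<^sub>F k in sequentially. \<beta> k * (X k)\<^sup>2 \<le> G k / 2 + b' * real k powr -r"
      using gap \<beta>_rate eventually_ge_at_top[of 1]
    proof eventually_elim
      case (elim k)
      have "\<beta> k * (X k)\<^sup>2 \<le> G k / 2 + (2 / \<kappa>) powr (2 / (q - 2)) * \<beta> k powr (q / (q - 2))"
        using q2 \<kappa> \<beta>0 elim(1) by (intro powr_absorb) (auto simp: X_def)
      also have "\<beta> k powr (q / (q - 2)) \<le> (b * real k powr -s) powr (1 / \<mu>)"
        unfolding mu_q using elim \<beta>0 mu1 by (intro powr_mono2) auto
      also have "\<dots> = b powr (1 / \<mu>) * real k powr -(s * (1 / \<mu>))"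
        using b0 by (simp add: powr_mult powr_powr)
      also have "\<dots> \<le> b powr (1 / \<mu>) * real k powr -r"
        using powr_le[OF rs elim(3)] by (intro mult_left_mono) auto
      finally show ?case by (simp add: b'_def mult.assoc mult_left_mono)
    qed
    then have "e \<in> O(\<lambda>k. real k powr -r)" using r by (intro e_rate[where b' = b']) (auto simp: b'_def)
    \<comment> \<open>Since \<open>r\<close> is a minimum, \<open>real k powr -r\<close> is one of
      the two entries of the maximum, so constant 1 works for every \<open>k\<close>.\<close>
    moreover have "(\<lambda>k. real k powr -r) \<in> O(\<lambda>k. max (1 / real k powr r') (1 / real k powr \<tau>))"
      by (intro bigoI[of _ 1]) (auto simp: r_def min_def max_def powr_minus divide_inverse
          intro!: always_eventually)
    ultimately show ?thesis
      using landau_o.big_trans unfolding r'_def s_def by blast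
  qed

  have case_delta: "e \<in> O(\<lambda>k. 1 / real k powr (1 - \<delta>))" if "q = 2" "1 - \<delta> \<le> \<tau>" for \<delta>
  proof -
    have "(\<lambda>k. 1 / real k powr \<tau>) \<in> O(\<lambda>k. 1 / real k powr (1 - \<delta>))"
      using that(2) by (intro bigoI[of _ 1] eventually_mono[OF eventually_ge_at_top[of 1]])
        (auto intro!: divide_left_mono powr_mono)
    then show ?thesis using case_q2[OF that(1)] landau_o.big_trans by blast
  qed
  have "q = 2" if "\<mu> = 0" using that C_unif(1) by (simp add: mu field_simps)
  then show ?thesis
    using e_eq case_q2 case_mu case_delta by (intro exI[of _ e]) auto
qed

end
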